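(* Let $G$ be a graded $\mathbb{K}$-Lie group with homogeneous dimension $Q$, where $\mathbb{K}$ is a nonarchimedean local field with residue field of cardinality $q$. Let $\alpha\in\mathbb{C}$ with $\mathrm{Re}(\alpha)>0$, $\alpha\notin\frac{2\pi i}{\ln q}\mathbb{Z}$ and $\mathrm{Re}(\alpha)\neq Q$. Then a fundamental solution for the Vladimirov-Taibleson operator $\mathscr{D}^\alpha$ on $G$ is given by $$E_\alpha(x)=\frac{1-q^{-\alpha}}{1-q^{\alpha-Q}}\,|x|_G^{\alpha-Q}.$$
   Context: Let $p\neq 2$ be a prime and $\mathbb{K}$ a nonarchimedean local field (an extension of $\mathbb{Q}_p$) with ring of integers $\mathcal{O}_{\mathbb{K}}$, uniformizer $\varpi$, residue field $\mathbb{F}_q$ and absolute value with $|\varpi|_{\mathbb{K}}=q^{-1}$. A nilpotent $\mathbb{K}$-Lie algebra $\mathfrak{g}$ is graded if $\mathfrak{g}=\bigoplus_k V_k$ with $[V_i,V_j]\subseteq V_{i+j}$; let $V_{\nu_1},\dots,V_{\nu_r}$ be the non-trivial summands, $b_k=\dim V_{\nu_k}$. The homogeneous dimension is $Q=\nu_1b_1+\dots+\nu_rb_r$. The group $G=\exp(\mathfrak{g})$ (with product given by the Baker–Campbell–Hausdorff formula) is called a graded $\mathbb{K}$-Lie group. For $\gamma\in\mathbb{K}^*$ the dilation $D_\gamma$ is the automorphism of $\mathfrak{g}$ acting as $\gamma^{\nu_k}$ on $V_{\nu_k}$, transported to $G$ by the exponential map. Fix a $\mathbb{K}$-basis $X_1,\dots,X_m$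 of $\mathfrak{g}$ of eigenvectors of the dilations, let $\mathfrak{g}_0=\mathcal{O}_{\mathbb{K}}X_1+\dots+\mathcal{O}_{\mathbb{K}}X_m$, $G_0=\exp(\mathfrak{g}_0)$ and $G_n=D_{\varpi^n}(G_0)$ for $n\in\mathbb{Z}$. It is a standing assumption that the $G_n$ are compact open subgroups; then $\{G_n\}_{n\in\mathbb{Z}}$ is strictly decreasing, has union $G$ and intersection $\{e\}$, and $|G_n/G_{n+1}|=q^Q$. The Haar measure is normalised by $|G_0|=1$. Define $|e|_G=0$ and $|x|_G=q^{-n}$ if $x\in G_n\setminus G_{n+1}$ (equivalently $|x|_G=|G_n|^{1/Q}$). $\mathcal{D}(G)$ is the space of locally constant complex functions with compact support on $G$. For $\mathrm{Re}(\alpha)>0$ and $f\in\mathcal{D}(G)$, $$\mathscr{D}^\alpha f(x)=\frac{1-q^\alpha}{1-q^{-(\alpha+Q)}}\int_G\frac{f(xy^{-1})-f(x)}{|y|_G^{\alpha+Q}}\,dy .$$ Convolution is $(g*k)(x)=\int_G g(y)\,k(y^{-1}x)\,dy$. A fundamental solution of $\mathscr{D}^\alpha$ is a distribution $E$ (linear functional on $\mathcal{D}(G)$) such that $\mathscr{D}^\alpha*E=\delta_e$, that is, $(\mathscr{D}^\alpha f)*E=f$ for every $f\in\mathcal{D}(G)$. *)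

theory Defs
  imports "HOL-Analysis.Analysis" "HOL-Algebra.Group"
begin

section \<open>Nonarchimedean local fields of characteristic zero\<close>

class absval = minus + zero +
  fixes absv :: "'a \<Rightarrow> real"
begin

definition integer_ring :: "'a set" where
  "integer_ring = {x. absv x \<le> 1}"

text \<open>The residue field as a set: integers modulo the maximal ideal of elements with \<open>absv x < 1\<close>.\<close>
definition residue_field :: "'a set set" where
  "residue_field =
     integer_ring // {(x, y). x \<in> integer_ring \<and> y \<in> integer_ring \<and> absv (x - y) < 1}"

definition uniformizer :: "'a \<Rightarrow> bool" where
  "uniformizer \<pi> \<longleftrightarrow> \<pi> \<noteq> 0 \<and> absv \<pi> < 1 \<and> (\<forall>x. absv x < 1 \<longrightarrow> absv x \<le> absv \<pi>)"

end

text \<open>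
  A complete discretely valued field of characteristic 0 with finite residue field \<open>F\<^sub>q\<close>, with its
  absolute value normalised by \<open>\<bar>\<pi>\<bar> = 1/q\<close>.  For residue characteristic \<open>p\<close>
  these are exactly the finite extensions of \<open>\<rat>\<^sub>p\<close>.  The library reserves \<open>norm\<close> for
  real vector spaces, hence the separate \<open>absv\<close>.
\<close>
class nonarch_local_field = field_char_0 + complete_space + absval +
  assumes dist_absv: "dist x y = absv (x - y)"
    and absv_mult: "absv (x * y) = absv x * absv y"
    and absv_ultrametric: "absv (x + y) \<le> max (absv x) (absv y)"
    and finite_residue_field: "finite residue_field"
    and ex_uniformizer: "\<exists>\<pi>. uniformizer \<pi> \<and> absv \<pi> = 1 / real (card residue_field)"

definition residue_card :: "'k::nonarch_local_field itself \<Rightarrow> nat" where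
  "residue_card _ = card (residue_field :: 'k set set)"

section \<open>Nilpotent Lie algebras and the Baker--Campbell--Hausdorff product\<close>

locale lie_algebra = vector_space scale
  for scale :: "'k::field_char_0 \<Rightarrow> 'g::ab_group_add \<Rightarrow> 'g" (infixr \<open>*\<^sub>K\<close> 75) +
  fixes bracket :: "'g \<Rightarrow> 'g \<Rightarrow> 'g"
  assumes bracket_add_left: "bracket (x + y) z = bracket x z + bracket y z"
    and bracket_add_right: "bracket x (y + z) = bracket x y + bracket x z"
    and bracket_scale_left: "bracket (c *\<^sub>K x) y = c *\<^sub>K bracket x y"
    and bracket_scale_right: "bracket x (c *\<^sub>K y) = c *\<^sub>K bracket x y"
    and bracket_self: "bracket x x = 0"
    and jacobi:
      "bracket x (bracket y z) + bracket y (bracket z x) + bracket z (bracket x y) = 0"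
begin

primrec lower_central :: "nat \<Rightarrow> 'g set" where
  "lower_central 0 = UNIV"
| "lower_central (Suc n) = span {bracket x y | x y. y \<in> lower_central n}"

definition nilpotent :: bool where
  "nilpotent \<longleftrightarrow> (\<exists>n. lower_central n = {0})"

definition nilpotency_class :: nat where
  "nilpotency_class = (LEAST n. lower_central n = {0})"

text \<open>\<open>nested_bracket [x\<^sub>1, \<dots>, x\<^sub>n] = [x\<^sub>1, [x\<^sub>2, \<dots> [x\<^sub>n\<^sub>-\<^sub>1, x\<^sub>n]]]\<close>.\<close>
fun nested_bracket :: "'g list \<Rightarrow> 'g" where
  "nested_bracket [] = 0"
| "nested_bracket [x] = x"
| "nested_bracket (x # y # zs) = bracket x (nested_bracket (y # zs))"

text \<open>
  Dynkin's form of the Baker--Campbell--Hausdorff series.  The exponent list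
  \<open>[(r\<^sub>1, s\<^sub>1), \<dots>, (r\<^sub>n, s\<^sub>n)]\<close> with all \<open>r\<^sub>i + s\<^sub>i > 0\<close> contributes
  \<open>(-1)\<^sup>n\<^sup>-\<^sup>1 / n\<close> times \<open>1 / (\<Sum>(r\<^sub>i + s\<^sub>i) * \<Prod>(r\<^sub>i! * s\<^sub>i!))\<close> times the nested bracket of the
  word \<open>x\<^bsup>r\<^sub>1\<^esup> y\<^bsup>s\<^sub>1\<^esup> \<dots> x\<^bsup>r\<^sub>n\<^esup> y\<^bsup>s\<^sub>n\<^esup>\<close>.
  In a nilpotent Lie algebra the terms of total degree above the nilpotency class vanish, so the
  series is the finite sum \<open>bch\<close>.
\<close>
definition dynkin_exponents :: "nat \<Rightarrow> (nat \<times> nat) list set" where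
  "dynkin_exponents d =
     {rs. rs \<noteq> [] \<and> (\<forall>(r, s) \<in> set rs. r + s > 0) \<and> (\<Sum>(r, s)\<leftarrow>rs. r + s) = d}"

definition dynkin_term :: "'g \<Rightarrow> 'g \<Rightarrow> (nat \<times> nat) list \<Rightarrow> 'g" where
  "dynkin_term x y rs =
     ((- 1) ^ (length rs - 1) /
        (of_nat (length rs) * of_nat (\<Sum>(r, s)\<leftarrow>rs. r + s) * (\<Prod>(r, s)\<leftarrow>rs. fact r * fact s)))
     *\<^sub>K nested_bracket (concat (map (\<lambda>(r, s). replicate r x @ replicate s y) rs))"

definition bch :: "'g \<Rightarrow> 'g \<Rightarrow> 'g" where
  "bch x y = (\<Sum>d = 1..nilpotency_class. \<Sum>rs\<in>dynkin_exponents d. dynkin_term x y rs)"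

text \<open>The group \<open>exp \<gg>\<close> in exponential coordinates: \<open>exp x\<close> is represented by \<open>x\<close>.\<close>
definition exp_group :: "'g monoid" where
  "exp_group = \<lparr>carrier = UNIV, monoid.mult = bch, one = 0\<rparr>"

end

section \<open>Graded Lie algebras and dilations\<close>

locale graded_lie_algebra = lie_algebra scale bracket
  for scale :: "'k::field_char_0 \<Rightarrow> 'g::ab_group_add \<Rightarrow> 'g" (infixr \<open>*\<^sub>K\<close> 75)
    and bracket :: "'g \<Rightarrow> 'g \<Rightarrow> 'g" +
  fixes V :: "nat \<Rightarrow> 'g set"
  assumes nilpotent: nilpotent
    and subspace_V: "subspace (V k)"
    and V_0: "V 0 = {0}"
    and direct_sum:
      "\<exists>!f. (\<forall>k. f k \<in> V k) \<and> finite {k. f k \<noteq> 0} \<and> x = (\<Sum>k | f k \<noteq> 0. f k)"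
    and bracket_V: "x \<in> V i \<Longrightarrow> y \<in> V j \<Longrightarrow> bracket x y \<in> V (i + j)"
begin

definition component :: "'g \<Rightarrow> nat \<Rightarrow> 'g" where
  "component x =
     (THE f. (\<forall>k. f k \<in> V k) \<and> finite {k. f k \<noteq> 0} \<and> x = (\<Sum>k | f k \<noteq> 0. f k))"

definition dilation :: "'k \<Rightarrow> 'g \<Rightarrow> 'g" where
  "dilation \<gamma> x = (\<Sum>k | component x k \<noteq> 0. \<gamma> ^ k *\<^sub>K component x k)"

definition homogeneous_dim :: nat where
  "homogeneous_dim = (\<Sum>k | V k \<noteq> {0}. k * dim (V k))"

end

section \<open>Graded Lie groups over local fields\<close>

locale graded_lie_group_basis = graded_lie_algebra scale bracket V
  for scale :: "'k::nonarch_local_field \<Rightarrow> 'g::ab_group_add \<Rightarrow> 'g" (infixr \<open>*\<^sub>K\<close> 75)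
    and bracket :: "'g \<Rightarrow> 'g \<Rightarrow> 'g"
    and V :: "nat \<Rightarrow> 'g set" +
  fixes B :: "'g set" and \<pi> :: 'k
  assumes uniformizer: "uniformizer \<pi>"
    and finite_basis: "finite B"
    and independent_basis: "independent B"
    and span_basis: "span B = UNIV"
    and eigenvector_basis: "b \<in> B \<Longrightarrow> \<gamma> \<noteq> 0 \<Longrightarrow> \<exists>c. dilation \<gamma> b = c *\<^sub>K b"
begin

text \<open>The topology of \<open>K\<^sup>m\<close>, transported by the coordinates with respect to \<open>B\<close>.\<close>
definition group_topology :: "'g topology" where
  "group_topology =
     pullback_topology UNIV (\<lambda>x. \<lambda>b\<in>B. representation B x b) (product_topology (\<lambda>_. euclidean) B)"

definition lattice :: "'g set" where
  "lattice = {\<Sum>b\<in>B. a b *\<^sub>K b | a. \<forall>b\<in>B. a b \<in> integer_ring}"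

definition G_sub :: "int \<Rightarrow> 'g set" where
  "G_sub n = dilation (\<pi> powi n) ` lattice"

definition gnorm :: "'g \<Rightarrow> real" where
  "gnorm x = (if x = \<one>\<^bsub>exp_group\<^esub> then 0
     else real (residue_card TYPE('k)) powi (- (THE n. x \<in> G_sub n - G_sub (n + 1))))"

text \<open>Locally constant functions with compact support.\<close>
definition test_functions :: "('g \<Rightarrow> complex) set" where
  "test_functions = {f.
     (\<forall>x. \<exists>U. openin group_topology U \<and> x \<in> U \<and> (\<forall>y\<in>U. f y = f x)) \<and>
     compactin group_topology (group_topology closure_of {x. f x \<noteq> 0})}"

definition distribution :: "(('g \<Rightarrow> complex) \<Rightarrow> complex) \<Rightarrow> bool" where
  "distribution T \<longleftrightarrow>
     (\<forall>\<phi>\<in>test_functions. \<forall>\<psi>\<in>test_functions. T (\<lambda>x. \<phi> x + \<psi> x) = T \<phi> + T \<psi>) \<and>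
     (\<forall>c. \<forall>\<phi>\<in>test_functions. T (\<lambda>x. c * \<phi> x) = c * T \<phi>)"

end

text \<open>
  \<open>\<mu>\<close> is the Haar measure, on the Borel sets of \<open>group_topology\<close>.  By the
  Baker--Campbell--Hausdorff theorem \<open>group_exp\<close> holds in every nilpotent Lie algebra; it is
  recorded here as part of the structure, since \<open>subgroup\<close> is only meaningful in a group.
  \<open>nontrivial\<close> is what makes the filtration \<open>G_sub\<close> strictly decreasing.
\<close>
locale graded_lie_group = graded_lie_group_basis scale bracket V B \<pi>
  for scale :: "'k::nonarch_local_field \<Rightarrow> 'g::ab_group_add \<Rightarrow> 'g" (infixr \<open>*\<^sub>K\<close> 75)
    and bracket :: "'g \<Rightarrow> 'g \<Rightarrow> 'g"
    and V :: "nat \<Rightarrow> 'g set"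
    and B :: "'g set"
    and \<pi> :: 'k +
  fixes \<mu> :: "'g measure"
  assumes nontrivial: "\<exists>x::'g. x \<noteq> 0"
    and group_exp: "group exp_group"
    and subgroup_G_sub: "subgroup (G_sub n) exp_group"
    and openin_G_sub: "openin group_topology (G_sub n)"
    and compactin_G_sub: "compactin group_topology (G_sub n)"
    and sets_haar: "sets \<mu> = sets (sigma UNIV {U. openin group_topology U})"
    and haar_left_invariant:
      "A \<in> sets \<mu> \<Longrightarrow> emeasure \<mu> ((\<lambda>x. g \<otimes>\<^bsub>exp_group\<^esub> x) ` A) = emeasure \<mu> A"
    and haar_compact: "compactin group_topology C \<Longrightarrow> emeasure \<mu> C < \<infinity>"
    and haar_normalised: "emeasure \<mu> (G_sub 0) = 1"
begin

text \<open>
  At the identity \<open>y = \<one>\<close> the conventions \<open>0 powr a = 0\<close> and \<open>z / 0 = 0\<close> make the integrand 0;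
  this affects only a null set.
\<close>
definition vladimirov_taibleson :: "complex \<Rightarrow> ('g \<Rightarrow> complex) \<Rightarrow> 'g \<Rightarrow> complex" where
  "vladimirov_taibleson \<alpha> f x =
     (let q = (of_nat (residue_card TYPE('k)) :: complex); Q = (of_nat homogeneous_dim :: complex)
      in (1 - q powr \<alpha>) / (1 - q powr (- (\<alpha> + Q))) *
         (LINT y|\<mu>. (f (x \<otimes>\<^bsub>exp_group\<^esub> inv\<^bsub>exp_group\<^esub> y) - f x)
                     / complex_of_real (gnorm y) powr (\<alpha> + Q)))"

definition convolution :: "('g \<Rightarrow> complex) \<Rightarrow> ('g \<Rightarrow> complex) \<Rightarrow> 'g \<Rightarrow> complex" where
  "convolution g k x = (LINT y|\<mu>. g y * k (inv\<^bsub>exp_group\<^esub> y \<otimes>\<^bsub>exp_group\<^esub> x))"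

text \<open>
  A function \<open>E\<close> is a fundamental solution if it is locally integrable, hence defines the
  distribution \<open>\<phi> \<mapsto> \<integral> E \<phi>\<close>, and \<open>(D\<^sup>\<alpha> f) * E = f\<close> for all test functions, where the
  convolution integrals converge absolutely.  Integrability is stated explicitly because the
  integral of a non-integrable function is 0 by convention.
\<close>
definition fundamental_solution :: "complex \<Rightarrow> ('g \<Rightarrow> complex) \<Rightarrow> bool" where
  "fundamental_solution \<alpha> E \<longleftrightarrow>
     (\<forall>\<phi>\<in>test_functions. integrable \<mu> (\<lambda>x. E x * \<phi> x)) \<and>
     distribution (\<lambda>\<phi>. LINT x|\<mu>. E x * \<phi> x) \<and>
     (\<forall>f\<in>test_functions.
        (\<forall>x. integrable \<mu>
               (\<lambda>y. vladimirov_taibleson \<alpha> f y * E (inv\<^bsub>exp_group\<^esub> y \<otimes>\<^bsub>exp_group\<^esub> x))) \<and>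
        convolution (vladimirov_taibleson \<alpha> f) E = f)"

end

end

(*
  Both kernels are radial: they only depend on the shell G_k - G_(k+1) containing the point.
  Every test function is a finite combination of indicators of left cosets a G_N, and everything
  commutes with left translations, so it suffices to treat f = 1_(G_N). Since |y| = |x| whenever
  y lies in G_N x and x is outside G_N, the function D f is again radial, constant on G_N and a
  multiple of |x|^(-alpha-Q) outside. The convolution of D f with |x|^(alpha-Q) at x in G_n -
  G_(n+1) is computed by splitting at |y| < |x|, |y| = |x| and |y| > |x|; each piece is a
  geometric series, and the series converge because |x|^(-alpha-Q) |x|^(alpha-Q) = |x|^(-2Q) is
  integrable at infinity.

  That G_n has measure q^(-nQ) comes from [G_n : G_(n+1)] = q^Q: on the subspaces spanned by the
  basis vectors of weight at least j, the Baker-Campbell-Hausdorff product is addition modulo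
  weight j + 1, so that coset representatives can be chosen one weight at a time.
*)
theory Submission
  imports Defs "HOL-Algebra.Coset"
begin

section \<open>Cosets and transversals\<close>

text \<open>The operator samples f at x y^-1, while the Haar measure is only given as left
  invariant, so right cosets G_n y have to be measured too. Left and right multiplication commute,
  hence the transversal that gives the index also cuts G_n y into left translates of G_(n+1) y; and
  G_m y = G_m once y lies in G_m. Together these give the unimodularity that the integrals need. The
  singularity of |y|^(-alpha-Q) at the identity never has to be estimated, since f(x y^-1) - f(x)
  vanishes for y near e. With a = q^alpha and R = q^Q, the geometric ratios that occur are 1/a and
  1/R, both of modulus below 1. The constant of E_alpha originates as follows: up to normalisation,
  the operator followed by convolution with the kernel multiplies 1_(G_N) by z = (1 - 1/(aR)) / (1 -
  a) * (1 - a/R) / (1 - 1/a). The first fraction is inverse to the constant of the operator, the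
  second to that of E_alpha. Re alpha \<noteq> Q ensures a/R \<noteq> 1. Off G_N the three pieces
  cancel exactly.\<close>

lemma (in group) mem_l_coset_iff_inv:
  assumes "carrier G = UNIV"
  shows "x \<in> g <# A \<longleftrightarrow> inv g \<otimes> x \<in> A"
proof
  assume "x \<in> g <# A"
  then show "inv g \<otimes> x \<in> A"
    by (auto simp: l_coset_def m_assoc[symmetric] assms)
next
  assume "inv g \<otimes> x \<in> A"
  moreover have "x = g \<otimes> (inv g \<otimes> x)"
    by (simp add: m_assoc[symmetric] assms)
  ultimately show "x \<in> g <# A"
    by (auto simp: l_coset_def)
qed

lemma (in group) mem_r_coset_iff_inv:
  assumes "carrier G = UNIV"
  shows "x \<in> A #> g \<longleftrightarrow> x \<otimes> inv g \<in> A"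
proof
  assume "x \<in> A #> g"
  then show "x \<otimes> inv g \<in> A"
    by (auto simp: r_coset_def m_assoc assms)
next
  assume "x \<otimes> inv g \<in> A"
  moreover have "x = (x \<otimes> inv g) \<otimes> g"
    by (simp add: m_assoc assms)
  ultimately show "x \<in> A #> g"
    by (auto simp: r_coset_def)
qed

text \<open>Read \<open>P r x\<close> as "r represents x". Reflexivity of \<open>P\<close> on
  \<open>X\<close> forces injectivity: \<open>f p\<close> lies in \<open>X\<close>, and only one
  parameter represents it. Counting parameters therefore counts representatives.\<close>

lemma transversal_image:
  assumes "\<And>x. x \<in> X \<Longrightarrow> \<exists>!p. p \<in> A \<and> P (f p) x" "f ` A \<subseteq> X" "\<And>x. x \<in> X \<Longrightarrow> P x x"
  shows "inj_on f A" "x \<in> X \<Longrightarrow> \<exists>!r. r \<in> f ` A \<and> P r x"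
proof -
  show "inj_on f A"
  proof (rule inj_onI)
    fix p p'
    assume p: "p \<in> A" "p' \<in> A" "f p = f p'"
    then have "f p \<in> X"
      using assms(2) by blast
    then have "\<exists>!p'. p' \<in> A \<and> P (f p') (f p)" "P (f p) (f p)"
      using assms(1,3) by auto
    then show "p = p'"
      using p by (metis (no_types))
  qed
  show "\<exists>!r. r \<in> f ` A \<and> P r x" if "x \<in> X"
    using assms(1)[OF that] by (auto elim!: ex1E)
qed

lemma ex1_unique: "\<exists>!x. P x \<Longrightarrow> P a \<Longrightarrow> P b \<Longrightarrow> a = b"
  by auto

section \<open>Arithmetic of the local field\<close>

lemma absv_0 [simp]: "absv (0::'k::nonarch_local_field) = 0"
  using dist_absv[of "0::'k" 0] by simp

lemma absv_eq_0_iff [simp]: "absv x = 0 \<longleftrightarrow> x = (0::'k::nonarch_local_field)"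
  by (metis dist_absv diff_zero dist_eq_0_iff)

lemma absv_nonneg [simp]: "0 \<le> absv (x::'k::nonarch_local_field)"
  using dist_absv[of x 0] zero_le_dist[of x 0] by simp

lemma absv_pos_iff [simp]: "0 < absv x \<longleftrightarrow> x \<noteq> (0::'k::nonarch_local_field)"
  using absv_nonneg[of x] absv_eq_0_iff[of x] by linarith

lemma absv_1 [simp]: "absv (1::'k::nonarch_local_field) = 1"
  using absv_mult[of "1::'k" 1] by simp

lemma absv_minus [simp]: "absv (- x) = absv (x::'k::nonarch_local_field)"
  using dist_absv[of x 0] dist_absv[of 0 x] by (simp add: dist_commute)

lemma absv_minus_commute: "absv (x - y) = absv (y - x :: 'k::nonarch_local_field)"
  using absv_minus[of "x - y"] by simp

lemma absv_add_le: "absv x \<le> C \<Longrightarrow> absv y \<le> C \<Longrightarrow> absv (x + y :: 'k::nonarch_local_field) \<le> C"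
  using absv_ultrametric[of x y] by linarith

lemma absv_sum_le:
  assumes "\<And>i. i \<in> I \<Longrightarrow> absv (f i :: 'k::nonarch_local_field) \<le> C" "0 \<le> C"
  shows "absv (sum f I) \<le> C"
  using assms by (induction I rule: infinite_finite_induct) (auto intro: absv_add_le)

lemma absv_power [simp]: "absv (x ^ n) = absv (x::'k::nonarch_local_field) ^ n"
  by (induction n) (simp_all add: absv_mult)

lemma absv_inverse [simp]: "absv (inverse x) = inverse (absv (x::'k::nonarch_local_field))"
proof (cases "x = 0")
  case False
  then have "absv x * absv (inverse x) = 1"
    by (simp flip: absv_mult)
  then show ?thesis
    using inverse_unique by metis
qed simp

lemma absv_divide [simp]: "absv (x / y) = absv x / absv (y::'k::nonarch_local_field)"
  by (simp add: divide_inverse absv_mult)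

lemma absv_power_int [simp]: "absv (x powi n) = absv (x::'k::nonarch_local_field) powi n"
  by (simp add: power_int_def)

text \<open>Two uniformizers bound each other's absolute value by maximality, so the normalisation
  of one of them holds for all.\<close>

lemma absv_uniformizer:
  assumes "uniformizer (\<pi>::'k::nonarch_local_field)"
  shows "absv \<pi> = 1 / real (residue_card TYPE('k))"
proof -
  obtain \<pi>' :: 'k where "uniformizer \<pi>'" "absv \<pi>' = 1 / real (card (residue_field :: 'k set set))"
    using ex_uniformizer by blast
  with assms show ?thesis
    unfolding uniformizer_def residue_card_def by (metis order_antisym)
qed

lemma residue_card_gt_1: "residue_card TYPE('k::nonarch_local_field) > 1"
proof -
  obtain \<pi> :: 'k where \<pi>: "uniformizer \<pi>"
    using ex_uniformizer by blast
  then have "0 < absv \<pi>" "absv \<pi> < 1"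
    by (auto simp: uniformizer_def)
  then show ?thesis
    unfolding absv_uniformizer[OF \<pi>] by (simp add: field_simps split: if_splits)
qed

text \<open>Discreteness of the valuation: the open unit ball is the closed ball of radius
  \<open>absv \<pi>\<close>, so that residue classes are classes modulo
  \<open>\<pi>\<close>.\<close>

lemma uniformizer_absv_less_1_iff:
  "uniformizer (\<pi>::'k::nonarch_local_field) \<Longrightarrow> absv (x::'k) < 1 \<longleftrightarrow> absv x \<le> absv \<pi>"
  unfolding uniformizer_def by (meson order_le_less_trans)

lemma ex_residue_transversal:
  "\<exists>T::'k::nonarch_local_field set. finite T \<and> card T = residue_card TYPE('k) \<and> (\<forall>t\<in>T. absv t \<le> 1) \<and>
     (\<forall>x. absv x \<le> 1 \<longrightarrow> (\<exists>!t. t \<in> T \<and> absv (x - t) < 1))"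
proof -
  define rel where "rel = {(x, y :: 'k). x \<in> integer_ring \<and> y \<in> integer_ring \<and> absv (x - y) < 1}"
  have eq: "equiv integer_ring rel"
  proof (rule equivI)
    show "trans rel"
    proof (rule transI)
      fix x y z
      assume "(x, y) \<in> rel" "(y, z) \<in> rel"
      then show "(x, z) \<in> rel"
        using absv_ultrametric[of "x - y" "y - z"] by (auto simp: rel_def)
    qed
  qed (auto simp: refl_on_def rel_def sym_def absv_minus_commute)
  have rf: "residue_field = (integer_ring :: 'k set) // rel"
    by (simp add: residue_field_def rel_def)
  define s :: "'k set \<Rightarrow> 'k" where "s C = (SOME x. x \<in> C)" for C
  have s: "s C \<in> C" if "C \<in> residue_field" for C
    using in_quotient_imp_non_empty[OF eq] that unfolding rf s_def by (metis some_in_eq)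
  have s_int: "s C \<in> integer_ring" if "C \<in> residue_field" for C
    using s[OF that] in_quotient_imp_subset[OF eq] that unfolding rf by blast
  have s_eq: "C = D" if "C \<in> residue_field" "D \<in> residue_field" "(s C, s D) \<in> rel" for C D
    using that s quotient_eqI[OF eq] unfolding rf by blast
  have refl: "(x, x) \<in> rel" if "x \<in> integer_ring" for x
    using that eq by (auto simp: equiv_def refl_on_def)
  have "inj_on s residue_field"
    using s_eq refl s_int by (metis inj_onI)
  then have "card (s ` residue_field) = residue_card TYPE('k)"
    by (simp add: card_image residue_card_def)
  moreover have "\<exists>!t. t \<in> s ` residue_field \<and> absv (x - t) < 1" if x: "absv x \<le> 1" for x
  proof -
    define C where "C = rel `` {x}"
    have C: "C \<in> residue_field"
      using x by (auto simp: rf C_def integer_ring_def intro: quotientI)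
    have xs: "(x, s C) \<in> rel"
      using s[OF C] by (auto simp: C_def)
    show ?thesis
    proof (rule ex1I[of _ "s C"])
      show "s C \<in> s ` residue_field \<and> absv (x - s C) < 1"
        using C xs by (auto simp: rel_def)
    next
      fix t
      assume t: "t \<in> s ` residue_field \<and> absv (x - t) < 1"
      then obtain D where D: "D \<in> residue_field" "t = s D"
        by blast
      have "(x, s D) \<in> rel"
        using t D s_int x by (auto simp: rel_def integer_ring_def)
      then have "(s D, s C) \<in> rel"
        using xs eq by (metis equiv_def symE transE)
      then show "t = s C"
        using s_eq C D by blast
    qed
  qed
  ultimately show ?thesis
    using finite_residue_field s_int
    by (intro exI[of _ "s ` residue_field"]) (auto simp: integer_ring_def)
qed

text \<open>Representatives modulo \<open>\<pi> ^ Suc j\<close> are truncated expansions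
  \<open>t + \<pi> ^ j * s\<close> with one more digit \<open>s\<close>. An integer determines first
  \<open>t\<close>, by its class modulo \<open>\<pi> ^ j\<close>, and then \<open>s\<close>, by the
  residue of the quotient.\<close>

lemma ex_power_transversal:
  assumes \<pi>: "uniformizer (\<pi>::'k::nonarch_local_field)"
  shows "\<exists>T :: 'k set. finite T \<and> card T = residue_card TYPE('k) ^ j \<and> (\<forall>t\<in>T. absv t \<le> 1) \<and>
     (\<forall>x. absv x \<le> 1 \<longrightarrow> (\<exists>!t. t \<in> T \<and> absv (x - t) \<le> absv \<pi> ^ j))"
proof (induction j)
  case 0
  show ?case
    by (intro exI[of _ "{0}"]) auto
next
  case (Suc j)
  obtain T :: "'k set" where T: "finite T" "card T = residue_card TYPE('k) ^ j" "\<forall>t\<in>T. absv t \<le> 1"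
    "\<forall>x. absv x \<le> 1 \<longrightarrow> (\<exists>!t. t \<in> T \<and> absv (x - t) \<le> absv \<pi> ^ j)"
    using Suc by blast
  obtain S :: "'k set" where S: "finite S" "card S = residue_card TYPE('k)" "\<forall>s\<in>S. absv s \<le> 1"
    "\<forall>x. absv x \<le> 1 \<longrightarrow> (\<exists>!s. s \<in> S \<and> absv (x - s) < 1)"
    using ex_residue_transversal by blast
  have \<pi>0: "\<pi> \<noteq> 0" "0 < absv \<pi>" "absv \<pi> < 1"
    using \<pi> by (auto simp: uniformizer_def)
  then have pj: "0 < absv \<pi> ^ j" "absv \<pi> ^ j \<le> 1"
    by (auto intro: power_le_one)
  let ?f = "\<lambda>(t, s). t + \<pi> ^ j * s"
  have ball_iff: "absv (x - ?f (t, s)) \<le> absv \<pi> ^ Suc j \<longleftrightarrow> absv ((x - t) / \<pi> ^ j - s) < 1" for x t s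
  proof -
    have "x - ?f (t, s) = \<pi> ^ j * ((x - t) / \<pi> ^ j - s)"
      using \<pi>0 by (simp add: field_simps)
    then have "absv (x - ?f (t, s)) = absv \<pi> ^ j * absv ((x - t) / \<pi> ^ j - s)"
      by (simp only: absv_mult absv_power)
    then show ?thesis
      using pj \<pi>0 uniformizer_absv_less_1_iff[OF \<pi>] by simp
  qed
  have unique: "t = t' \<and> s = s'"
    if "t \<in> T" "s \<in> S" "t' \<in> T" "s' \<in> S" "absv x \<le> 1"
      "absv (x - ?f (t, s)) \<le> absv \<pi> ^ Suc j" "absv (x - ?f (t', s')) \<le> absv \<pi> ^ Suc j" for x t s t' s'
  proof -
    \<comment> \<open>Dropping the digit \<open>s\<close> costs at most
      \<open>absv \<pi> ^ j\<close>, so by the ultrametric inequality the coarser approximation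
      survives.\<close>
    have close: "absv (x - t) \<le> absv \<pi> ^ j"
      if "s \<in> S" "absv (x - ?f (t, s)) \<le> absv \<pi> ^ Suc j" for t s
    proof -
      have "absv \<pi> ^ Suc j \<le> absv \<pi> ^ j"
        using \<pi>0 pj by simp
      moreover have "absv (\<pi> ^ j * s) \<le> absv \<pi> ^ j"
        using S(3) that(1) pj by (simp add: absv_mult mult_le_cancel_left1)
      ultimately show ?thesis
        using absv_add_le[of "x - ?f (t, s)" "absv \<pi> ^ j" "\<pi> ^ j * s"] that(2) by simp
    qed
    have "\<exists>!t. t \<in> T \<and> absv (x - t) \<le> absv \<pi> ^ j"
      using T(4) that(5) by simp
    then have t: "t = t'"
      by (rule ex1_unique) (use that(1,3) close[OF that(2,6)] close[OF that(4,7)] in simp_all)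
    have "absv ((x - t) / \<pi> ^ j) \<le> 1"
      using close[OF that(2) that(6)] pj by (simp add: divide_le_eq)
    moreover have "absv ((x - t) / \<pi> ^ j - s) < 1" "absv ((x - t) / \<pi> ^ j - s') < 1"
      using that(6,7) t unfolding ball_iff by auto
    moreover have "\<exists>!s. s \<in> S \<and> absv ((x - t) / \<pi> ^ j - s) < 1"
      using S(4) calculation(1) by simp
    ultimately have "s = s'"
      using ex1_unique[of "\<lambda>s. s \<in> S \<and> absv ((x - t) / \<pi> ^ j - s) < 1"] that(2,4) by simp
    with t show ?thesis
      by simp
  qed
  have f_int: "absv (?f (t, s)) \<le> 1" if "t \<in> T" "s \<in> S" for t s
    using that T(3) S(3) pj by (auto intro!: absv_add_le mult_le_one simp: absv_mult)
  have "inj_on ?f (T \<times> S)"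
  proof (rule inj_onI, clarify)
    fix t s t' s'
    assume *: "t \<in> T" "s \<in> S" "t' \<in> T" "s' \<in> S" "t + \<pi> ^ j * s = t' + \<pi> ^ j * s'"
    \<comment> \<open>Injectivity is \<open>unique\<close> for the point \<open>?f (t, s)\<close>
      itself, which both pairs approximate with error 0.\<close>
    then show "t = t' \<and> s = s'"
      using unique[of t s t' s' "?f (t, s)"] f_int[of t s] \<pi>0 by simp
  qed
  then have "card (?f ` (T \<times> S)) = residue_card TYPE('k) ^ Suc j"
    by (simp add: card_image card_cartesian_product T S)
  moreover have "\<exists>!u. u \<in> ?f ` (T \<times> S) \<and> absv (x - u) \<le> absv \<pi> ^ Suc j" if x: "absv x \<le> 1" for x
  proof -
    obtain t where t: "t \<in> T" "absv (x - t) \<le> absv \<pi> ^ j"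
      using T(4) x by blast
    then have "absv ((x - t) / \<pi> ^ j) \<le> 1"
      using pj by (simp add: divide_le_eq)
    then obtain s where s: "s \<in> S" "absv ((x - t) / \<pi> ^ j - s) < 1"
      using S(4) by blast
    show ?thesis
    proof (rule ex1I[of _ "?f (t, s)"])
      show "?f (t, s) \<in> ?f ` (T \<times> S) \<and> absv (x - ?f (t, s)) \<le> absv \<pi> ^ Suc j"
        using t s unfolding ball_iff by blast
    next
      fix u
      assume u: "u \<in> ?f ` (T \<times> S) \<and> absv (x - u) \<le> absv \<pi> ^ Suc j"
      then obtain t' s' where u': "t' \<in> T" "s' \<in> S" "u = ?f (t', s')"
        by auto
      have "absv (x - ?f (t, s)) \<le> absv \<pi> ^ Suc j"
        using s(2) unfolding ball_iff .
      moreover have "absv (x - ?f (t', s')) \<le> absv \<pi> ^ Suc j"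
        using u u'(3) by simp
      ultimately have "t = t' \<and> s = s'"
        by (rule unique[OF t(1) s(1) u'(1,2) x])
      then show "u = ?f (t, s)"
        using u' by auto
    qed
  qed
  ultimately show ?case
    using T(1) S(1) f_int by (intro exI[of _ "?f ` (T \<times> S)"]) auto
qed

text \<open>Multiplication by \<open>\<pi> powi m\<close> reduces this to the integral case;
  negative \<open>m\<close> occurs because the filtration is indexed by all integers.\<close>

lemma ex_fractional_transversal:
  assumes \<pi>: "uniformizer (\<pi>::'k::nonarch_local_field)"
  shows "\<exists>T :: 'k set. finite T \<and> card T = residue_card TYPE('k) ^ j \<and> (\<forall>t\<in>T. absv t \<le> absv \<pi> powi m) \<and>
     (\<forall>x. absv x \<le> absv \<pi> powi m \<longrightarrow> (\<exists>!t. t \<in> T \<and> absv (x - t) \<le> absv \<pi> powi (m + int j)))"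
proof -
  obtain T :: "'k set" where T: "finite T" "card T = residue_card TYPE('k) ^ j" "\<forall>t\<in>T. absv t \<le> 1"
    "\<forall>x. absv x \<le> 1 \<longrightarrow> (\<exists>!t. t \<in> T \<and> absv (x - t) \<le> absv \<pi> ^ j)"
    using ex_power_transversal[OF \<pi>, of j] by blast
  have \<pi>0: "\<pi> \<noteq> 0"
    using \<pi> by (auto simp: uniformizer_def)
  define z where "z = \<pi> powi m"
  have z: "z \<noteq> 0" "absv z > 0" "absv \<pi> powi m = absv z" "absv \<pi> powi (m + int j) = absv z * absv \<pi> ^ j"
    using \<pi>0 by (simp_all add: z_def power_int_add)
  have "card ((*) z ` T) = card T"
    using z by (intro card_image) (simp add: inj_on_def)
  moreover have "\<exists>!t. t \<in> (*) z ` T \<and> absv (x - t) \<le> absv z * absv \<pi> ^ j" if x: "absv x \<le> absv z" for x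
  proof -
    have scaled: "absv (x - z * t) \<le> absv z * absv \<pi> ^ j \<longleftrightarrow> absv (x / z - t) \<le> absv \<pi> ^ j" for t
    proof -
      have "x - z * t = z * (x / z - t)"
        using z by (simp add: field_simps)
      then show ?thesis
        using z by (simp add: absv_mult)
    qed
    have "absv (x / z) \<le> 1"
      using x z by (simp add: divide_le_eq)
    then have "\<exists>!t. t \<in> T \<and> absv (x / z - t) \<le> absv \<pi> ^ j"
      using T(4) by blast
    then show ?thesis
      unfolding scaled[symmetric] by blast
  qed
  moreover have "\<forall>t\<in>(*) z ` T. absv t \<le> absv z"
    using T(3) z by (auto simp: absv_mult)
  ultimately show ?thesis
    unfolding z(3,4) using T by (intro exI[of _ "(*) z ` T"]) auto
qed

section \<open>Radial kernels on a group with a filtration by subgroups\<close>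

text \<open>At each point at most one term is nonzero, so \<open>f\<close> is the pointwise sum of
  multiples of indicators. Measurability, integrability and the value all come from termwise
  integration, which asks only that the integrals of the norms be summable.\<close>

lemma has_bochner_integral_suminf_const_on:
  fixes w :: "nat \<Rightarrow> complex"
  assumes sets: "\<And>i. A i \<in> sets M"
    and fin: "\<And>i. emeasure M (A i) < \<infinity>"
    and disj: "disjoint_family A"
    and summ: "summable (\<lambda>i. norm (w i) * measure M (A i))"
    and f_on: "\<And>i x. x \<in> A i \<Longrightarrow> f x = w i"
    and f_off: "\<And>x. x \<in> space M \<Longrightarrow> x \<notin> (\<Union>i. A i) \<Longrightarrow> f x = 0"
  shows "has_bochner_integral M f (\<Sum>i. w i * measure M (A i))"
proof -
  define g where "g i x = w i * indicator (A i) x" for i x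
  have sum_at: "(\<lambda>i. g i x) sums f x" if "x \<in> space M" for x
  proof (cases "x \<in> (\<Union>i. A i)")
    case True
    then obtain j where j: "x \<in> A j"
      by blast
    have "g i x = (if i = j then f x else 0)" for i
      using disj j f_on by (auto simp: g_def indicator_def disjoint_family_on_def)
    then have "(\<lambda>i. g i x) = (\<lambda>i. if i = j then f x else 0)"
      by auto
    then show ?thesis
      using sums_single[of j "\<lambda>_. f x"] by simp
  next
    case False
    then have "(\<lambda>i. g i x) = (\<lambda>_. 0)"
      by (auto simp: g_def)
    with False that f_off show ?thesis
      by simp
  qed
  have norm_summable: "summable (\<lambda>i. norm (g i x))" for x
  proof (cases "x \<in> (\<Union>i. A i)")
    case True
    then obtain j where j: "x \<in> A j"
      by blast
    have "norm (g i x) = 0" if "i \<notin> {j}" for i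
      using disj j that by (auto simp: g_def indicator_def disjoint_family_on_def)
    then show ?thesis
      by (intro summable_finite[of "{j}"]) auto
  qed (auto simp: g_def)
  have int_g: "has_bochner_integral M (g i) (w i * measure M (A i))" for i
    unfolding g_def
    using has_bochner_integral_mult_right[OF has_bochner_integral_of_real[OF
        has_bochner_integral_real_indicator[OF sets fin]], of "w i" i]
    by (simp add: of_real_indicator)
  have int_norm: "integral\<^sup>L M (\<lambda>x. norm (g i x)) = norm (w i) * measure M (A i)" for i
  proof -
    have "(\<lambda>x. norm (g i x)) = (\<lambda>x. norm (w i) * indicator (A i) x)"
      by (auto simp: g_def indicator_def norm_mult)
    then show ?thesis
      using sets[of i] by (simp add: Int_absorb1 sets.sets_into_space Int_commute)
  qed
  have *: "\<And>i. integrable M (g i)" "AE x in M. summable (\<lambda>i. norm (g i x))"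
    "summable (\<lambda>i. integral\<^sup>L M (\<lambda>x. norm (g i x)))"
    using int_g norm_summable summ by (auto simp: int_norm has_bochner_integral_iff)
  have "has_bochner_integral M (\<lambda>x. \<Sum>i. g i x) (\<Sum>i. integral\<^sup>L M (g i))"
    using integrable_suminf[OF *] integral_suminf[OF *] by (simp add: has_bochner_integral_iff)
  moreover have "integral\<^sup>L M (g i) = w i * measure M (A i)" for i
    using int_g by (rule has_bochner_integral_integral_eq)
  moreover have "has_bochner_integral M (\<lambda>x. \<Sum>i. g i x) z \<longleftrightarrow> has_bochner_integral M f z" for z
    using sum_at by (intro has_bochner_integral_cong) (auto simp: sums_iff)
  ultimately show ?thesis
    by simp
qed

lemma has_bochner_integral_geometric:
  fixes w :: "nat \<Rightarrow> complex" and \<rho> C :: complex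
  assumes sets: "\<And>i. A i \<in> sets M"
    and fin: "\<And>i. emeasure M (A i) < \<infinity>"
    and disj: "disjoint_family A"
    and geom: "\<And>i. w i * measure M (A i) = C * \<rho> ^ i"
    and \<rho>: "norm \<rho> < 1"
    and f_on: "\<And>i x. x \<in> A i \<Longrightarrow> f x = w i"
    and f_off: "\<And>x. x \<in> space M \<Longrightarrow> x \<notin> (\<Union>i. A i) \<Longrightarrow> f x = 0"
  shows "has_bochner_integral M f (C / (1 - \<rho>))"
proof -
  have "norm (w i) * measure M (A i) = norm C * norm \<rho> ^ i" for i
    using arg_cong[OF geom[of i], of norm] by (simp add: norm_mult norm_power)
  then have "summable (\<lambda>i. norm (w i) * measure M (A i))"
    using \<rho> by (simp add: summable_mult summable_geometric)
  then have "has_bochner_integral M f (\<Sum>i. w i * measure M (A i))"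
    by (rule has_bochner_integral_suminf_const_on[OF sets fin disj _ f_on f_off])
  moreover have "(\<Sum>i. w i * measure M (A i)) = C / (1 - \<rho>)"
    using \<rho> by (simp add: geom suminf_mult suminf_geometric summable_geometric)
  ultimately show ?thesis
    by simp
qed

text \<open>Isolates what the analysis uses of the group: \<open>H n\<close> stands for the n-th
  dilate and \<open>H_transversal\<close> for the index \<open>q ^ Q\<close>. Invariance is
  one-sided; right cosets enter only through their measurability
  \<open>sets_r_coset\<close>.\<close>

locale haar_filtration = group G for G :: "'a monoid" (structure) +
  fixes H :: "int \<Rightarrow> 'a set" and M :: "'a measure" and q Q :: nat
  assumes carrier_UNIV [simp]: "carrier G = UNIV"
    and subgroup_H: "subgroup (H n) G"
    and H_Suc_subset: "H (n + 1) \<subseteq> H n"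
    and H_exhausts: "\<exists>n. x \<in> H n"
    and H_separates: "x \<noteq> \<one> \<Longrightarrow> \<exists>n. x \<notin> H n"
    and q_gt_1: "q > 1"
    and Q_pos: "Q > 0"
    and space_M: "space M = UNIV"
    and translation_measurable [measurable]: "(\<otimes>) g \<in> M \<rightarrow>\<^sub>M M"
    and left_invariant: "distr M M ((\<otimes>) g) = M"
    and sets_H [measurable]: "H n \<in> sets M"
    and sets_r_coset: "H n #> g \<in> sets M"
    and emeasure_H_0: "emeasure M (H 0) = 1"
    and H_transversal: "\<exists>R. finite R \<and> card R = q ^ Q \<and> H n = (\<Union>g\<in>R. g <# H (n + 1)) \<and>
      disjoint_family_on (\<lambda>g. g <# H (n + 1)) R"
begin

lemma H_one: "\<one> \<in> H n"
  using subgroup_H by (rule subgroup.one_closed)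

lemma H_mult: "x \<in> H n \<Longrightarrow> y \<in> H n \<Longrightarrow> x \<otimes> y \<in> H n"
  using subgroup_H by (rule subgroup.m_closed)

lemma H_inv: "x \<in> H n \<Longrightarrow> inv x \<in> H n"
  using subgroup_H by (rule subgroup.m_inv_closed)

lemma H_inv_iff [simp]: "inv x \<in> H n \<longleftrightarrow> x \<in> H n"
  using H_inv[of x n] H_inv[of "inv x" n] by auto

lemma H_mult_left_iff: "x \<in> H n \<Longrightarrow> x \<otimes> y \<in> H n \<longleftrightarrow> y \<in> H n"
  by (metis H_inv H_mult carrier_UNIV UNIV_I inv_solve_left)

lemma H_mult_right_iff: "y \<in> H n \<Longrightarrow> x \<otimes> y \<in> H n \<longleftrightarrow> x \<in> H n"
  by (metis H_inv H_mult carrier_UNIV UNIV_I inv_solve_right)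

lemma H_antimono: "m \<le> n \<Longrightarrow> H n \<subseteq> H m"
proof (induction n rule: int_ge_induct)
  case (step i)
  then show ?case
    using H_Suc_subset[of i] by blast
qed simp

lemma H_antimonoD: "x \<in> H n \<Longrightarrow> m \<le> n \<Longrightarrow> x \<in> H m"
  using H_antimono by blast

section \<open>Shells and the ultrametric norm\<close>

definition shell :: "int \<Rightarrow> 'a set" where
  "shell n = H n - H (n + 1)"

lemma sets_shell [measurable]: "shell n \<in> sets M"
  unfolding shell_def by measurable

text \<open>On the way from some \<open>H m\<close> containing \<open>x\<close> to some
  \<open>H k\<close> not containing it, the filtration loses \<open>x\<close> at a definite
  step.\<close>

lemma ex_shell:
  assumes "x \<noteq> \<one>"
  shows "\<exists>n. x \<in> shell n"
proof -
  obtain m k where mk: "x \<in> H m" "x \<notin> H k"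
    using H_exhausts H_separates assms by metis
  have step: "\<exists>n. x \<in> shell n" if "x \<in> H m" "x \<notin> H (m + int j)" for j
    using that
  proof (induction j)
    case (Suc j)
    have "m + int (Suc j) = (m + int j) + 1"
      by simp
    with Suc show ?case
      unfolding shell_def by (metis DiffI)
  qed simp
  have "m \<le> k"
    using mk H_antimonoD[of x m k] by linarith
  then show ?thesis
    using step[of "nat (k - m)"] mk by simp
qed

lemma shell_unique:
  assumes "x \<in> shell m" "x \<in> shell n"
  shows "m = n"
proof (rule ccontr)
  assume "m \<noteq> n"
  then have "m + 1 \<le> n \<or> n + 1 \<le> m"
    by linarith
  with assms show False
    using H_antimonoD by (auto simp: shell_def)
qed

lemma one_notin_shell: "\<one> \<notin> shell n"
  by (simp add: shell_def H_one)

lemma shell_subset_iff: "x \<in> shell n \<Longrightarrow> x \<in> H m \<longleftrightarrow> m \<le> n"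
  using H_antimonoD[of x "m" "n + 1"] H_antimonoD[of x n m] by (force simp: shell_def)

text \<open>Written in the same shape as \<open>gnorm\<close>, so that both unfold to the same term
  once \<open>H\<close> is instantiated.\<close>

definition hnorm :: "'a \<Rightarrow> real" where
  "hnorm x = (if x = \<one> then 0 else real q powi (- (THE n. x \<in> H n - H (n + 1))))"

lemma hnorm_shell: "x \<in> shell n \<Longrightarrow> hnorm x = real q powi (- n)"
proof -
  assume x: "x \<in> shell n"
  then have "(THE n. x \<in> H n - H (n + 1)) = n"
    unfolding shell_def[symmetric] using shell_unique by blast
  with x show ?thesis
    using one_notin_shell by (auto simp: hnorm_def)
qed

text \<open>The norm sees \<open>x\<close> only through the set of \<open>m\<close> with
  \<open>x \<in> H m\<close>; even \<open>x = \<one>\<close> can be read off there, because the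
  \<open>H m\<close> separate points from the identity. Ultrametric rules thus reduce to
  membership.\<close>

lemma hnorm_cong:
  assumes "\<And>m. x \<in> H m \<longleftrightarrow> y \<in> H m"
  shows "hnorm x = hnorm y"
proof -
  have "x = \<one> \<longleftrightarrow> y = \<one>"
    using H_separates[of x] H_separates[of y] assms H_one by blast
  then show ?thesis
    by (simp add: hnorm_def assms)
qed

text \<open>The isosceles property for |y| > |x|: for m \<le> n the factor \<open>x\<close> lies in
  \<open>H m\<close> and cancels, while for m > n either membership would put \<open>y\<close> into
  \<open>H n\<close>.\<close>

lemma hnorm_inv_mult_outer:
  assumes "x \<in> H n" "y \<notin> H n"
  shows "hnorm (inv y \<otimes> x) = hnorm y"
proof (rule hnorm_cong)
  fix m
  show "inv y \<otimes> x \<in> H m \<longleftrightarrow> y \<in> H m"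
  proof (cases "m \<le> n")
    case True
    then show ?thesis
      using assms H_antimonoD[of x n m] by (simp add: H_mult_right_iff)
  next
    case False
    then show ?thesis
      using assms H_antimonoD[of y m n] H_antimonoD[of "inv y \<otimes> x" m n]
      by (auto simp: H_mult_right_iff)
  qed
qed

text \<open>The isosceles property for |y| < |x|: now \<open>y\<close> cancels for m \<le> n, while
  for m > n either membership would put \<open>x\<close> into \<open>H n\<close>.\<close>

lemma hnorm_inv_mult_inner:
  assumes "x \<notin> H n" "y \<in> H n"
  shows "hnorm (inv y \<otimes> x) = hnorm x"
proof (rule hnorm_cong)
  fix m
  show "inv y \<otimes> x \<in> H m \<longleftrightarrow> x \<in> H m"
  proof (cases "m \<le> n")
    case True
    then show ?thesis
      using assms H_antimonoD[of y n m] by (simp add: H_mult_left_iff)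
  next
    case False
    then show ?thesis
      using assms H_antimonoD[of x m n] H_antimonoD[of "inv y \<otimes> x" m n]
      by (auto simp: H_mult_left_iff)
  qed
qed

text \<open>The radial kernel |x|^\<beta>. Its value at the identity is 0 by the convention
  \<open>0 powr \<beta> = 0\<close>, so \<open>kern_add\<close> holds at every point.\<close>

definition kern :: "complex \<Rightarrow> 'a \<Rightarrow> complex" where
  "kern \<beta> x = complex_of_real (hnorm x) powr \<beta>"

lemma kern_one [simp]: "kern \<beta> \<one> = 0"
  by (simp add: kern_def hnorm_def)

lemma kern_add: "kern (\<beta> + \<gamma>) x = kern \<beta> x * kern \<gamma> x"
  by (simp add: kern_def powr_add)

text \<open>The base is a positive real, so its complex logarithm is the real one, and the integer
  exponent -n leaves the complex power without any choice of branch.\<close>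

lemma kern_shell:
  assumes "x \<in> shell n"
  shows "kern \<beta> x = (of_nat q powr \<beta>) powi (- n)"
proof -
  have q: "real q > 0"
    using q_gt_1 by simp
  have "complex_of_real (hnorm x) powr \<beta> = exp (\<beta> * of_real (ln (real q powi (- n))))"
    using q by (simp add: hnorm_shell[OF assms] powr_def Ln_of_real del: power_int_minus of_real_power_int)
  also have "ln (real q powi (- n)) = - real_of_int n * ln (real q)"
    using q powr_real_of_int'[of "real q" "- n"] by (metis ln_powr of_int_minus less_imp_le not_le)
  also have "exp (\<beta> * complex_of_real (- real_of_int n * ln (real q))) = exp (of_int (- n) * (\<beta> * of_real (ln q)))"
    by (simp add: algebra_simps)
  also have "\<dots> = exp (\<beta> * of_real (ln q)) powi (- n)"
    by (rule exp_power_int[symmetric])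
  also have "exp (\<beta> * of_real (ln q)) = of_nat q powr \<beta>"
    using q Ln_of_real[OF q] q_gt_1 by (simp add: powr_def)
  finally show ?thesis
    by (simp add: kern_def)
qed

lemma mem_l_coset_iff: "x \<in> g <# A \<longleftrightarrow> inv g \<otimes> x \<in> A"
  by (simp add: mem_l_coset_iff_inv)

lemma mem_r_coset_iff: "x \<in> A #> g \<longleftrightarrow> x \<otimes> inv g \<in> A"
  by (simp add: mem_r_coset_iff_inv)

section \<open>Haar measure of left and right cosets\<close>

lemma l_coset_eq_vimage: "g <# A = (\<otimes>) (inv g) -` A"
  by (auto simp: mem_l_coset_iff)

lemma sets_l_coset [measurable]: "A \<in> sets M \<Longrightarrow> g <# A \<in> sets M"
  using measurable_sets[OF translation_measurable, of A "inv g"]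
  by (simp add: l_coset_eq_vimage space_M)

lemma emeasure_l_coset:
  assumes "A \<in> sets M"
  shows "emeasure M (g <# A) = emeasure M A"
proof -
  have "emeasure M A = emeasure (distr M M ((\<otimes>) (inv g))) A"
    by (simp add: left_invariant)
  also have "\<dots> = emeasure M (g <# A)"
    using assms by (simp add: emeasure_distr l_coset_eq_vimage space_M)
  finally show ?thesis ..
qed

text \<open>The decomposition of \<open>H n\<close> into left translates of \<open>H (n + 1)\<close>
  is multiplied by \<open>y\<close> on the right; the pieces remain left translates, now of
  \<open>H (n + 1) #> y\<close>, so left invariance suffices.\<close>

lemma emeasure_r_coset_Suc: "emeasure M (H n #> y) = of_nat (q ^ Q) * emeasure M (H (n + 1) #> y)"
proof -
  obtain R where R: "finite R" "card R = q ^ Q" "H n = (\<Union>g\<in>R. g <# H (n + 1))"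
    "disjoint_family_on (\<lambda>g. g <# H (n + 1)) R"
    using H_transversal by blast
  have "H n #> y = (\<Union>g\<in>R. g <# (H (n + 1) #> y))"
    by (subst R) (auto simp: mem_l_coset_iff mem_r_coset_iff m_assoc)
  moreover have "disjoint_family_on (\<lambda>g. g <# (H (n + 1) #> y)) R"
    using R(4) by (fastforce simp: disjoint_family_on_def set_eq_iff mem_l_coset_iff mem_r_coset_iff m_assoc)
  ultimately have "emeasure M (H n #> y) = (\<Sum>g\<in>R. emeasure M (g <# (H (n + 1) #> y)))"
    using R(1) sets_r_coset by (simp add: sum_emeasure image_subset_iff sets_l_coset)
  then show ?thesis
    using R(2) sets_r_coset by (simp add: emeasure_l_coset)
qed

lemma emeasure_H_Suc: "emeasure M (H n) = of_nat (q ^ Q) * emeasure M (H (n + 1))"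
  using emeasure_r_coset_Suc[of n \<one>] by simp

abbreviation r :: real where "r \<equiv> real q ^ Q"

lemma r_gt_1: "r > 1"
  using q_gt_1 Q_pos by simp

lemma r_powi_Suc: "r powi (- (n + 1)) = r powi (- n) / r"
  using q_gt_1 power_int_add[of r "- n" "- 1"] by (simp add: divide_inverse)

lemma emeasure_H: "emeasure M (H n) = ennreal (r powi (- n))"
proof (induction n rule: int_induct[where k = 0])
  case base
  then show ?case
    by (simp add: emeasure_H_0)
next
  case (step1 i)
  have q: "of_nat (q ^ Q) = ennreal r" "ennreal r * ennreal (1 / r) = 1"
    using q_gt_1 by (simp_all add: ennreal_of_nat_eq_real_of_nat flip: ennreal_mult)
  have "emeasure M (H (i + 1)) = ennreal (1 / r) * emeasure M (H i)"
    using q by (simp add: emeasure_H_Suc[of i] mult.assoc[symmetric] mult.commute)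
  then show ?case
    unfolding r_powi_Suc using r_gt_1 step1 by (simp flip: ennreal_mult)
next
  case (step2 i)
  have q: "of_nat (q ^ Q) = ennreal r"
    by (simp add: ennreal_of_nat_eq_real_of_nat)
  show ?case
    using r_gt_1 step2 emeasure_H_Suc[of "i - 1"] q
    by (simp add: power_int_diff power_int_minus divide_inverse flip: ennreal_mult)
qed

text \<open>Unimodularity on the filtration. If \<open>y \<in> H m\<close>, the coset is
  \<open>H n\<close> itself for n \<le> m. Below that, both sides shrink by the same finite nonzero
  factor \<open>q ^ Q\<close> at each step.\<close>

lemma emeasure_r_coset: "emeasure M (H n #> y) = emeasure M (H n)"
proof -
  obtain m where m: "y \<in> H m"
    using H_exhausts by blast
  have ge: "emeasure M (H n #> y) = emeasure M (H n)" if "m \<le> n" for n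
    using that
  proof (induction n rule: int_ge_induct)
    case base
    have "H m #> y = H m"
      using m by (auto simp: mem_r_coset_iff H_mult_right_iff)
    then show ?case
      by simp
  next
    case (step n)
    have "of_nat (q ^ Q) * emeasure M (H (n + 1) #> y) = of_nat (q ^ Q) * emeasure M (H (n + 1))"
      using step emeasure_r_coset_Suc emeasure_H_Suc by metis
    then show ?case
      using q_gt_1 by (subst (asm) ennreal_mult_cancel_left) (auto simp: of_nat_power[symmetric] simp del: of_nat_power)
  qed
  show ?thesis
  proof (cases "m \<le> n")
    case True
    then show ?thesis
      by (rule ge)
  next
    case False
    then have "y \<in> H n"
      using m H_antimonoD by auto
    then have "H n #> y = H n"
      by (auto simp: mem_r_coset_iff H_mult_right_iff)
    then show ?thesis
      by simp
  qed
qed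

lemma measure_H: "measure M (H n) = r powi (- n)"
  using emeasure_H[of n] r_gt_1 by (simp add: measure_def del: power_int_minus)

lemma emeasure_shell_finite: "emeasure M (shell n) < \<infinity>"
proof -
  have "emeasure M (shell n) \<le> emeasure M (H n)"
    by (rule emeasure_mono) (auto simp: shell_def)
  then show ?thesis
    by (simp add: emeasure_H order_le_less_trans)
qed

lemma measure_shell: "measure M (shell n) = r powi (- n) * (1 - 1 / r)"
proof -
  have "measure M (shell n) = measure M (H n) - measure M (H (n + 1))"
    unfolding shell_def
    by (rule measure_Diff) (auto simp: emeasure_H H_Suc_subset sets_H)
  then show ?thesis
    unfolding measure_H r_powi_Suc by (simp add: algebra_simps)
qed

lemma measure_l_coset_shell: "measure M (g <# shell n) = r powi (- n) * (1 - 1 / r)"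
  by (simp add: measure_def emeasure_l_coset sets_shell flip: measure_shell)

section \<open>Integrals of radial kernels as geometric series\<close>

lemma has_bochner_integral_indicator_H:
  "has_bochner_integral M (\<lambda>y. indicator (H n) y * c) (of_real (r powi (- n)) * (c :: complex))"
  using has_bochner_integral_mult_left[OF has_bochner_integral_of_real[OF
      has_bochner_integral_real_indicator[of "H n" M]], of c]
  by (simp add: sets_H emeasure_H measure_H of_real_indicator del: power_int_minus of_real_power_int of_real_power)

text \<open>The two directions are inwards to the centre and outwards to infinity. The factors
  \<open>1\<close> and \<open>- 1\<close> stay unsimplified because the integral lemmas match these
  terms by \<open>simp_all only\<close>.\<close>

lemma disjoint_shells:
  "disjoint_family (\<lambda>i::nat. g <# shell (n + 1 * int i))"
  "disjoint_family (\<lambda>i::nat. g <# shell (n + (- 1) * int i))"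
  unfolding disjoint_family_on_def using shell_unique by (force simp: mem_l_coset_iff)+

lemma inv_mem_shell_iff [simp]: "inv x \<in> shell n \<longleftrightarrow> x \<in> shell n"
  by (simp add: shell_def)

text \<open>Shells are centred at \<open>x\<close>, since \<open>x <# H n = H n\<close>. On the i-th
  one, kernel times measure is \<open>b powi (- (n + i))\<close> up to the factor
  \<open>1 - 1 / r\<close>, so the ratio is \<open>1 / b\<close>; the bound on \<open>b\<close> says
  Re \<beta> > -Q. The centre y = x lies in no shell and has kernel value 0.\<close>

lemma has_bochner_integral_kern_inner:
  fixes \<beta> :: complex
  defines "b \<equiv> of_nat q powr \<beta> * of_real r"
  assumes x: "x \<in> H n" and b: "norm b > 1"
  shows "has_bochner_integral M (\<lambda>y. indicator (H n) y * kern \<beta> (inv y \<otimes> x))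
    (b powi (- n) * (1 - 1 / of_real r) / (1 - 1 / b))"
proof (rule has_bochner_integral_geometric[where A = "\<lambda>i. x <# shell (n + 1 * int i)"
      and w = "\<lambda>i. (of_nat q powr \<beta>) powi (- (n + int i))"])
  fix i :: nat
  show "x <# shell (n + 1 * int i) \<in> sets M"
    by (intro sets_l_coset sets_shell)
  show "emeasure M (x <# shell (n + 1 * int i)) < \<infinity>"
    by (simp only: emeasure_l_coset sets_shell emeasure_shell_finite)
  have b0: "b \<noteq> 0"
    using b by auto
  have "(of_nat q powr \<beta>) powi (- (n + int i)) * of_real (r powi (- (n + int i)))
      = b powi (- (n + int i))"
    by (simp add: b_def power_int_mult_distrib)
  also have "\<dots> = b powi (- n) * (1 / b) ^ i"
    using b0 by (simp add: power_int_diff power_int_minus divide_inverse power_inverse)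
  finally show "(of_nat q powr \<beta>) powi (- (n + int i)) * of_real (measure M (x <# shell (n + 1 * int i))) =
      b powi (- n) * (1 - 1 / of_real r) * (1 / b) ^ i"
    by (simp add: measure_l_coset_shell del: power_int_minus minus_add_distrib)
  fix y
  assume y: "y \<in> x <# shell (n + 1 * int i)"
  then have *: "inv x \<otimes> y \<in> shell (n + int i)"
    by (simp add: mem_l_coset_iff)
  then have "inv (inv x \<otimes> y) \<in> shell (n + int i)"
    by (simp only: inv_mem_shell_iff)
  then have "inv y \<otimes> x \<in> shell (n + int i)"
    by (simp add: inv_mult_group)
  moreover have "y \<in> H n"
    using * x shell_subset_iff[OF *, of n] by (simp add: H_mult_left_iff)
  ultimately show "indicator (H n) y * kern \<beta> (inv y \<otimes> x) = (of_nat q powr \<beta>) powi (- (n + int i))"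
    by (simp add: kern_shell del: power_int_minus)
next
  fix y
  assume *: "y \<notin> (\<Union>i. x <# shell (n + 1 * int i))"
  show "indicator (H n) y * kern \<beta> (inv y \<otimes> x) = 0"
  proof (cases "y \<in> H n \<and> inv y \<otimes> x \<noteq> \<one>")
    case True
    then obtain k where k: "inv y \<otimes> x \<in> shell k"
      using ex_shell by blast
    have "inv y \<otimes> x \<in> H n"
      using True x by (simp add: H_mult)
    then have "n \<le> k"
      using k shell_subset_iff by blast
    have "inv (inv y \<otimes> x) \<in> shell k"
      using k by (simp only: inv_mem_shell_iff)
    then have "inv x \<otimes> y \<in> shell (n + 1 * int (nat (k - n)))"
      using \<open>n \<le> k\<close> by (simp add: inv_mult_group)
    with * show ?thesis
      by (auto simp only: mem_l_coset_iff)
  qed auto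
next
  show "norm (1 / b) < 1"
    using b by (auto simp: norm_divide divide_less_eq)
qed (simp_all only: disjoint_shells)

text \<open>The complement of \<open>H N\<close> consists of the shells N - 1, N - 2, ..., which
  explains the exponent \<open>1 - N\<close>. The ratio is \<open>b\<close>, and the bound on it
  says Re \<beta> < -Q. The coset by \<open>\<one>\<close> only serves to reuse the statements on
  translated shells.\<close>

lemma has_bochner_integral_kern_outer:
  fixes \<beta> :: complex
  defines "b \<equiv> of_nat q powr \<beta> * of_real r"
  assumes b: "norm b < 1"
  shows "has_bochner_integral M (\<lambda>y. indicator (- H N) y * kern \<beta> y)
    (b powi (1 - N) * (1 - 1 / of_real r) / (1 - b))"
proof (rule has_bochner_integral_geometric[where A = "\<lambda>i. \<one> <# shell (N - 1 + (- 1) * int i)"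
      and w = "\<lambda>i. (of_nat q powr \<beta>) powi (- (N - 1 - int i))"])
  fix i :: nat
  show "\<one> <# shell (N - 1 + (- 1) * int i) \<in> sets M"
    by (intro sets_l_coset sets_shell)
  show "emeasure M (\<one> <# shell (N - 1 + (- 1) * int i)) < \<infinity>"
    by (simp only: emeasure_l_coset sets_shell emeasure_shell_finite)
  have b0: "b \<noteq> 0"
    using q_gt_1 by (simp add: b_def)
  have "(of_nat q powr \<beta>) powi (- (N - 1 - int i)) * of_real (r powi (- (N - 1 - int i)))
      = b powi (1 - N + int i)"
    by (simp add: b_def power_int_mult_distrib algebra_simps)
  also have "\<dots> = b powi (1 - N) * b ^ i"
    using b0 by (subst power_int_add) auto
  finally show "(of_nat q powr \<beta>) powi (- (N - 1 - int i)) *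
      of_real (measure M (\<one> <# shell (N - 1 + (- 1) * int i))) =
      b powi (1 - N) * (1 - 1 / of_real r) * b ^ i"
    by (simp add: measure_l_coset_shell del: power_int_minus minus_diff_eq)
  fix y
  assume y: "y \<in> \<one> <# shell (N - 1 + (- 1) * int i)"
  then have *: "y \<in> shell (N - 1 - int i)"
    by (simp add: mem_l_coset_iff)
  then show "indicator (- H N) y * kern \<beta> y = (of_nat q powr \<beta>) powi (- (N - 1 - int i))"
    using shell_subset_iff[OF *, of N] by (simp add: kern_shell[OF *] del: power_int_minus)
next
  fix y
  assume *: "y \<notin> (\<Union>i. \<one> <# shell (N - 1 + (- 1) * int i))"
  show "indicator (- H N) y * kern \<beta> y = 0"
  proof (cases "y \<notin> H N")
    case True
    then obtain k where k: "y \<in> shell k"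
      using ex_shell H_one by metis
    then have "k < N"
      using True shell_subset_iff by (simp add: not_le)
    then have "inv \<one> \<otimes> y \<in> shell (N - 1 + (- 1) * int (nat (N - 1 - k)))"
      using k by simp
    with * show ?thesis
      by (auto simp only: mem_l_coset_iff)
  qed auto
qed (simp_all only: disjoint_shells b)

section \<open>The operator and the convolution on indicators of the filtration\<close>

definition vt :: "complex \<Rightarrow> ('a \<Rightarrow> complex) \<Rightarrow> 'a \<Rightarrow> complex" where
  "vt \<alpha> f x = (1 - of_nat q powr \<alpha>) / (1 - of_nat q powr (- (\<alpha> + of_nat Q))) *
     (LINT y|M. (f (x \<otimes> inv y) - f x) / complex_of_real (hnorm y) powr (\<alpha> + of_nat Q))"

lemma q_powr_Q: "of_nat q powr of_nat Q = complex_of_real r"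
  using q_gt_1 by (simp add: powr_nat')

lemma norm_q_powr: "norm (of_nat q powr \<alpha> :: complex) = real q powr Re \<alpha>"
  using norm_powr_real_powr[of "of_nat q" \<alpha>] by simp

lemma norm_q_powr_gt_1: "Re \<alpha> > 0 \<Longrightarrow> norm (of_nat q powr \<alpha> :: complex) > 1"
  using q_gt_1 by (simp add: norm_q_powr)

lemma q_powr_diff_Q: "of_nat q powr (\<alpha> - of_nat Q) = of_nat q powr \<alpha> / complex_of_real r"
  by (simp add: powr_diff q_powr_Q del: of_real_power)

lemma q_powr_minus_add_Q: "of_nat q powr (- (\<alpha> + of_nat Q)) = 1 / (of_nat q powr \<alpha> * complex_of_real r)"
  by (simp add: powr_minus powr_add q_powr_Q divide_inverse del: of_real_power minus_add_distrib)

text \<open>Closed form of the integral in \<open>vt\<close> for the indicator of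
  \<open>H N\<close>, without the normalising constant. The first branch is minus the mass of
  |y|^(-\<alpha>-Q) off \<open>H N\<close>, the second the mass of \<open>H N\<close> times the
  kernel at \<open>x\<close>.\<close>

definition vt_indicator_integral :: "complex \<Rightarrow> int \<Rightarrow> 'a \<Rightarrow> complex" where
  "vt_indicator_integral \<alpha> N x =
     (if x \<in> H N
      then - ((of_nat q powr \<alpha>) powi (N - 1) * (1 - 1 / of_real r) / (1 - 1 / of_nat q powr \<alpha>))
      else of_real (r powi (- N)) * kern (- (\<alpha> + of_nat Q)) x)"

text \<open>For \<open>x \<in> H N\<close> the integrand lives where \<open>y \<notin> H N\<close>,
  and the outer series has ratio q^(-\<alpha>), so Re \<alpha> > 0 is the convergence condition. For
  \<open>x \<notin> H N\<close> it lives on the right coset \<open>H N #> x\<close>, where |y| is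
  constant; hence the need for the measure of right cosets.\<close>

lemma has_bochner_integral_vt_indicator:
  assumes "Re \<alpha> > 0"
  shows "has_bochner_integral M
    (\<lambda>y. (indicator (H N) (x \<otimes> inv y) - indicator (H N) x) / complex_of_real (hnorm y) powr (\<alpha> + of_nat Q))
    (vt_indicator_integral \<alpha> N x)"
proof -
  define a :: complex where "a = of_nat q powr \<alpha>"
  have a: "a \<noteq> 0" "norm a > 1"
    using norm_q_powr_gt_1[OF assms] q_gt_1 by (auto simp: a_def)
  have br: "of_nat q powr (- (\<alpha> + of_nat Q)) * complex_of_real r = 1 / a"
    unfolding q_powr_minus_add_Q using a q_gt_1 by (simp add: a_def)
  have div: "z / complex_of_real (hnorm y) powr (\<alpha> + of_nat Q) = z * kern (- (\<alpha> + of_nat Q)) y" for z y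
    unfolding kern_def powr_minus by (simp add: divide_inverse)
  show ?thesis
  proof (cases "x \<in> H N")
    case True
    have "has_bochner_integral M (\<lambda>y. indicator (- H N) y * kern (- (\<alpha> + of_nat Q)) y)
        ((1 / a) powi (1 - N) * (1 - 1 / of_real r) / (1 - 1 / a))"
      using has_bochner_integral_kern_outer[of "- (\<alpha> + of_nat Q)" N] a
      unfolding br by (simp add: norm_divide)
    then have "has_bochner_integral M (\<lambda>y. - (indicator (- H N) y * kern (- (\<alpha> + of_nat Q)) y))
        (- ((1 / a) powi (1 - N) * (1 - 1 / of_real r) / (1 - 1 / a)))"
      by (rule has_bochner_integral_minus)
    also have "(1 / a) powi (1 - N) = a powi (N - 1)"
      using power_int_minus[of a "1 - N"] by (simp add: divide_inverse power_int_inverse)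
    also have "(\<lambda>y. - (indicator (- H N) y * kern (- (\<alpha> + of_nat Q)) y)) =
        (\<lambda>y. (indicator (H N) (x \<otimes> inv y) - indicator (H N) x) / complex_of_real (hnorm y) powr (\<alpha> + of_nat Q))"
      unfolding div using True by (auto simp: indicator_def H_mult_left_iff)
    finally show ?thesis
      using True by (simp only: vt_indicator_integral_def a_def if_True)
  next
    case False
    have "has_bochner_integral M (\<lambda>y. indicator (H N #> x) y * kern (- (\<alpha> + of_nat Q)) x)
      (of_real (r powi (- N)) * kern (- (\<alpha> + of_nat Q)) x)"
      using has_bochner_integral_mult_left[OF has_bochner_integral_of_real[OF
          has_bochner_integral_real_indicator[of "H N #> x" M]], of "kern (- (\<alpha> + of_nat Q)) x"]
      by (simp add: sets_r_coset emeasure_r_coset emeasure_H measure_def of_real_indicator r_gt_1 less_imp_le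
          del: power_int_minus of_real_power_int of_real_power)
    also have "(\<lambda>y. indicator (H N #> x) y * kern (- (\<alpha> + of_nat Q)) x) =
        (\<lambda>y. (indicator (H N) (x \<otimes> inv y) - indicator (H N) x) / complex_of_real (hnorm y) powr (\<alpha> + of_nat Q))"
    proof
      fix y
      have *: "y \<in> H N #> x \<longleftrightarrow> x \<otimes> inv y \<in> H N"
        using H_inv_iff[of "x \<otimes> inv y" N] by (simp add: mem_r_coset_iff inv_mult_group del: H_inv_iff)
      show "indicator (H N #> x) y * kern (- (\<alpha> + of_nat Q)) x =
        (indicator (H N) (x \<otimes> inv y) - indicator (H N) x) / complex_of_real (hnorm y) powr (\<alpha> + of_nat Q)"
      proof (cases "x \<otimes> inv y \<in> H N")
        case True
        \<comment> \<open>Here \<open>y\<close> is written as the inverse of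
          \<open>x \<otimes> inv y\<close>, an element of \<open>H N\<close>, times
          \<open>x\<close>, which is outside \<open>H N\<close>; the isosceles property gives |y| =
          |x|.\<close>
        then have "hnorm (inv (x \<otimes> inv y) \<otimes> x) = hnorm x"
          using False by (intro hnorm_inv_mult_inner)
        moreover have "inv (x \<otimes> inv y) \<otimes> x = y"
          by (simp add: inv_mult_group m_assoc)
        ultimately have "kern (- (\<alpha> + of_nat Q)) y = kern (- (\<alpha> + of_nat Q)) x"
          by (simp add: kern_def)
        then show ?thesis
          unfolding div using True False * by simp
      next
        case False
        then show ?thesis
          using \<open>x \<notin> H N\<close> * by simp
      qed
    qed
    finally show ?thesis
      using False by (simp only: vt_indicator_integral_def if_False)
  qed
qed

lemma has_bochner_integral_convolution_indicator:
  fixes \<alpha> :: complex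
  assumes \<alpha>: "Re \<alpha> > 0" "Re \<alpha> \<noteq> real Q"
  shows "has_bochner_integral M
    (\<lambda>y. vt_indicator_integral \<alpha> N y * kern (\<alpha> - of_nat Q) (inv y \<otimes> x))
    ((1 - 1 / (of_nat q powr \<alpha> * of_real r)) / (1 - of_nat q powr \<alpha>) *
     ((1 - of_nat q powr \<alpha> / of_real r) / (1 - 1 / of_nat q powr \<alpha>)) * indicator (H N) x)"
proof -
  define a R :: complex where "a = of_nat q powr \<alpha>" and "R = of_real r"
  have a: "a \<noteq> 0" "norm a > 1" "a \<noteq> 1"
    using norm_q_powr_gt_1[OF \<alpha>(1)] q_gt_1 by (auto simp: a_def)
  have R: "R \<noteq> 0" "norm R > 1" "R \<noteq> 1"
    using r_gt_1 q_gt_1 by (auto simp: R_def norm_power simp del: of_real_power)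
  have "norm (a * R) > 1"
    using a(2) R(2) by (simp add: norm_mult less_1_mult)
  then have aR: "a * R \<noteq> 1"
    by auto
  have "norm a \<noteq> norm R"
    using \<alpha> q_gt_1 powr_inj[of "real q" "Re \<alpha>" "real Q"]
    by (simp add: a_def R_def norm_q_powr powr_realpow[symmetric] norm_power)
  then have neq: "a \<noteq> R"
    by auto
  have b1: "of_nat q powr (\<alpha> - of_nat Q) * complex_of_real r = a"
    unfolding q_powr_diff_Q using R by (simp add: a_def R_def)
  have b2: "of_nat q powr (- (\<alpha> + of_nat Q)) * complex_of_real r = 1 / a"
    unfolding q_powr_minus_add_Q using a R by (simp add: a_def R_def)
  \<comment> \<open>Numerically this is -2Q; kept as a sum so that \<open>kern_add\<close> splits
    it. The outer ratio becomes \<open>1 / R\<close>, independent of \<alpha>.\<close>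
  define \<gamma> where "\<gamma> = - (\<alpha> + of_nat Q) + (\<alpha> - of_nat Q)"
  have b3: "of_nat q powr \<gamma> * R = 1 / R"
    unfolding \<gamma>_def powr_add q_powr_minus_add_Q q_powr_diff_Q using a R by (simp add: a_def R_def)
  have kern_\<gamma>: "kern \<gamma> y = kern (- (\<alpha> + of_nat Q)) y * kern (\<alpha> - of_nat Q) y" for y
    unfolding \<gamma>_def by (rule kern_add)
  have inner: "has_bochner_integral M (\<lambda>y. indicator (H n) y * kern (\<alpha> - of_nat Q) (inv y \<otimes> x))
      (a powi (- n) * (1 - 1 / R) / (1 - 1 / a))" if "x \<in> H n" for n
    using has_bochner_integral_kern_inner[OF that, of "\<alpha> - of_nat Q"] a unfolding b1 R_def by simp
  have inverse_powi: "(1 / z) powi (1 - n) = z powi n / z" if "z \<noteq> 0" for z :: complex and n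
    using that by (simp add: power_int_divide_distrib power_int_diff)
  have outer2: "has_bochner_integral M (\<lambda>y. indicator (- H n) y * kern (- (\<alpha> + of_nat Q)) y)
      (a powi n / a * (1 - 1 / R) / (1 - 1 / a))" for n
    using has_bochner_integral_kern_outer[of "- (\<alpha> + of_nat Q)" n] a
    unfolding b2 R_def inverse_powi[OF a(1)] by (simp add: norm_divide)
  have outer3: "has_bochner_integral M
      (\<lambda>y. indicator (- H n) y * (kern (- (\<alpha> + of_nat Q)) y * kern (\<alpha> - of_nat Q) y)) (R powi n / R)" for n
    using has_bochner_integral_kern_outer[of \<gamma> n] R
    unfolding b3 inverse_powi[OF R(1)] kern_\<gamma> R_def[symmetric] by (simp add: norm_divide)
  have ind: "has_bochner_integral M (\<lambda>y. indicator (H n) y * c) (R powi (- n) * c)" for n c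
    using has_bochner_integral_indicator_H[of n c] by (simp add: R_def)
  let ?W = "- (a powi N / a * (1 - 1 / R) / (1 - 1 / a))"
  have V: "vt_indicator_integral \<alpha> N y =
      (if y \<in> H N then ?W else R powi (- N) * kern (- (\<alpha> + of_nat Q)) y)" for y
    using a by (simp add: vt_indicator_integral_def a_def[symmetric] R_def power_int_diff)
  show ?thesis
  proof (cases "x \<in> H N")
    case True
    \<comment> \<open>Within \<open>H N\<close> the operator contributes the constant
      \<open>?W\<close>; outside, |y^-1 x| = |y| merges the two kernels into
      \<open>kern \<gamma>\<close>.\<close>
    have "has_bochner_integral M
        (\<lambda>y. ?W * (indicator (H N) y * kern (\<alpha> - of_nat Q) (inv y \<otimes> x)) +
          R powi (- N) * (indicator (- H N) y * (kern (- (\<alpha> + of_nat Q)) y * kern (\<alpha> - of_nat Q) y)))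
        (?W * (a powi (- N) * (1 - 1 / R) / (1 - 1 / a)) + R powi (- N) * (R powi N / R))"
      by (intro has_bochner_integral_add has_bochner_integral_mult_right inner outer3 True)
    also have "?W * (a powi (- N) * (1 - 1 / R) / (1 - 1 / a)) + R powi (- N) * (R powi N / R) =
        - ((1 / a) * (1 - 1 / R) / (1 - 1 / a) * ((1 - 1 / R) / (1 - 1 / a))) + 1 / R"
      using a R by (simp add: power_int_minus)
    also have "\<dots> = (1 - 1 / (a * R)) / (1 - a) * ((1 - a / R) / (1 - 1 / a))"
      using a R by (simp add: divide_simps) algebra
    also have "\<dots> = \<dots> * indicator (H N) x"
      using True by simp
    also have "(\<lambda>y. ?W * (indicator (H N) y * kern (\<alpha> - of_nat Q) (inv y \<otimes> x)) +
          R powi (- N) * (indicator (- H N) y * (kern (- (\<alpha> + of_nat Q)) y * kern (\<alpha> - of_nat Q) y))) =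
        (\<lambda>y. vt_indicator_integral \<alpha> N y * kern (\<alpha> - of_nat Q) (inv y \<otimes> x))"
    proof
      fix y
      have "kern (\<alpha> - of_nat Q) (inv y \<otimes> x) = kern (\<alpha> - of_nat Q) y" if "y \<notin> H N"
        unfolding kern_def using hnorm_inv_mult_outer[OF True that] by simp
      then show "?W * (indicator (H N) y * kern (\<alpha> - of_nat Q) (inv y \<otimes> x)) +
          R powi (- N) * (indicator (- H N) y * (kern (- (\<alpha> + of_nat Q)) y * kern (\<alpha> - of_nat Q) y)) =
          vt_indicator_integral \<alpha> N y * kern (\<alpha> - of_nat Q) (inv y \<otimes> x)"
        unfolding V by simp
    qed
    finally show ?thesis
      unfolding a_def R_def .
  next
    case False
    then obtain n where n: "x \<in> shell n"
      using ex_shell H_one by metis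
    then have xn: "x \<in> H n" "x \<notin> H (n + 1)" and "n < N"
      using False shell_subset_iff[OF n] by (auto simp: not_le)
    then have sub: "H N \<subseteq> H (n + 1)" "H (n + 1) \<subseteq> H n"
      using H_antimono[of "n + 1" N] H_Suc_subset by auto
    define Ex Ux where "Ex = kern (\<alpha> - of_nat Q) x" and "Ux = kern (- (\<alpha> + of_nat Q)) x"
    have Ex: "Ex = R powi n / a powi n"
      unfolding Ex_def kern_shell[OF n] q_powr_diff_Q a_def R_def
      by (simp add: power_int_minus power_int_divide_distrib)
    have Ux: "Ux = a powi n * R powi n"
      unfolding Ux_def kern_shell[OF n] q_powr_minus_add_Q a_def R_def
      by (simp add: power_int_minus power_int_divide_distrib power_int_mult_distrib)
    \<comment> \<open>On \<open>H (n + 1)\<close> the convolution kernel is the constant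
      \<open>Ex\<close>, on the shell of \<open>x\<close> the other kernel is the constant
      \<open>Ux\<close>, and off \<open>H n\<close> both depend on |y| alone. The regions
      \<open>H (n + 1) - H N\<close> and \<open>H n - H (n + 1)\<close> are differences of regions
      whose integrals are known.\<close>
    let ?F = "\<lambda>y. Ex * (indicator (H N) y * ?W + R powi (- N) *
          (indicator (- H N) y * kern (- (\<alpha> + of_nat Q)) y - indicator (- H (n + 1)) y * kern (- (\<alpha> + of_nat Q)) y)) +
        R powi (- N) * Ux * (indicator (H n) y * kern (\<alpha> - of_nat Q) (inv y \<otimes> x) - indicator (H (n + 1)) y * Ex) +
        R powi (- N) * (indicator (- H n) y * (kern (- (\<alpha> + of_nat Q)) y * kern (\<alpha> - of_nat Q) y))"
    have "has_bochner_integral M ?F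
        (Ex * (R powi (- N) * ?W + R powi (- N) *
          (a powi N / a * (1 - 1 / R) / (1 - 1 / a) - a powi (n + 1) / a * (1 - 1 / R) / (1 - 1 / a))) +
        R powi (- N) * Ux * (a powi (- n) * (1 - 1 / R) / (1 - 1 / a) - R powi (- (n + 1)) * Ex) +
        R powi (- N) * (R powi n / R))" (is "has_bochner_integral M _ ?v")
      by (intro has_bochner_integral_add has_bochner_integral_diff has_bochner_integral_mult_right
          inner outer2 outer3 ind xn)
    also have "?v = 0"
    proof -
      have Rn: "R powi (- (n + 1)) = 1 / (R * R powi n)"
        using R by (subst power_int_minus) (simp add: power_int_add divide_inverse)
      have an: "a powi (n + 1) = a * a powi n"
        and an': "a powi (- n) = 1 / a powi n"
        using a by (simp_all add: power_int_minus_divide power_int_add)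
      have "a powi n \<noteq> 0" "R powi n \<noteq> 0"
        using a R by auto
      define An Rn where "An = a powi n" and "Rn = R powi n"
      have nz: "An \<noteq> 0" "Rn \<noteq> 0"
        using a R by (auto simp: An_def Rn_def)
      \<comment> \<open>In terms of \<open>K\<close> the three summands are R^n R^(-N) times -K, K -
        1/R and 1/R, so they cancel.\<close>
      define K where "K = (1 - 1 / R) / (1 - 1 / a)"
      have K: "z * (1 - 1 / R) / (1 - 1 / a) = z * K" for z
        by (simp add: K_def)
      show ?thesis
        unfolding Ex Ux Rn an an' An_def[symmetric] Rn_def[symmetric] K
        using nz a R by (simp add: field_simps)
    qed
    also have "?F = (\<lambda>y. vt_indicator_integral \<alpha> N y * kern (\<alpha> - of_nat Q) (inv y \<otimes> x))"
    proof
      fix y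
      consider "y \<notin> H n" | "y \<in> H n" "y \<notin> H (n + 1)" | "y \<in> H (n + 1)"
        by blast
      then show "?F y = vt_indicator_integral \<alpha> N y * kern (\<alpha> - of_nat Q) (inv y \<otimes> x)"
      proof cases
        case 1
        then have "kern (\<alpha> - of_nat Q) (inv y \<otimes> x) = kern (\<alpha> - of_nat Q) y"
          unfolding kern_def using hnorm_inv_mult_outer[OF xn(1) 1] by simp
        moreover have "y \<notin> H (n + 1)" "y \<notin> H N"
          using 1 sub by auto
        ultimately show ?thesis
          unfolding V using 1 by simp
      next
        case 2
        then have y: "y \<in> shell n" "y \<notin> H N"
          using sub by (auto simp: shell_def)
        have "kern (- (\<alpha> + of_nat Q)) y = Ux"
          unfolding Ux_def kern_shell[OF n] kern_shell[OF y(1)] ..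
        then show ?thesis
          unfolding V using 2 \<open>y \<notin> H N\<close> by simp
      next
        case 3
        then have "kern (\<alpha> - of_nat Q) (inv y \<otimes> x) = Ex"
          unfolding kern_def Ex_def using hnorm_inv_mult_inner[OF xn(2) 3] by simp
        moreover have "y \<in> H n"
          using 3 sub by auto
        ultimately show ?thesis
          unfolding V using 3 by (simp add: algebra_simps)
      qed
    qed
    finally show ?thesis
      using False by simp
  qed
qed

section \<open>From indicators to step functions\<close>

lemma has_bochner_integral_translate:
  fixes F :: "'a \<Rightarrow> complex"
  assumes "has_bochner_integral M F v"
  shows "has_bochner_integral M (\<lambda>y. F (g \<otimes> y)) v"
proof -
  have F: "F \<in> borel_measurable M" "has_bochner_integral (distr M M ((\<otimes>) g)) F v"
    using assms by (auto simp: left_invariant has_bochner_integral_iff)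
  then show ?thesis
    using integrable_distr_eq[OF translation_measurable F(1)] integral_distr[OF translation_measurable F(1)]
    by (simp add: has_bochner_integral_iff)
qed

text \<open>The coset lies in a subgroup \<open>H m\<close> containing both \<open>g\<close> and
  \<open>H n\<close>, so integrability over \<open>H m\<close> is enough. The inner integral at the
  identity involves \<open>inv y\<close>, which has the same norm as \<open>y\<close>.\<close>

lemma integrable_kern_indicator:
  assumes "norm (of_nat q powr \<beta> * complex_of_real r) > 1"
  shows "integrable M (\<lambda>y. kern \<beta> y * indicator (g <# H n) y)"
proof -
  obtain k where k: "g \<in> H k"
    using H_exhausts by blast
  define m where "m = min k n"
  have m: "g \<in> H m" "H n \<subseteq> H m"
    using k H_antimonoD H_antimono by (auto simp: m_def)
  have "integrable M (\<lambda>y. indicator (H m) y * kern \<beta> (inv y \<otimes> \<one>))"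
    using has_bochner_integral_kern_inner[OF H_one assms] by (simp add: has_bochner_integral_iff)
  moreover have "kern \<beta> (inv y \<otimes> \<one>) = kern \<beta> y" for y
    using hnorm_cong[of "inv y" y] by (simp add: kern_def)
  ultimately have "integrable M (\<lambda>y. indicator (H m) y * kern \<beta> y)"
    by simp
  then have "integrable M (\<lambda>y. indicator (g <# H n) y *\<^sub>R (indicator (H m) y * kern \<beta> y))"
    by (intro integrable_mult_indicator sets_l_coset sets_H)
  moreover have "y \<in> H m" if "y \<in> g <# H n" for y
    using that m H_mult[of g m] by (auto simp: l_coset_def)
  then have "(\<lambda>y. indicator (g <# H n) y *\<^sub>R (indicator (H m) y * kern \<beta> y)) =
      (\<lambda>y. kern \<beta> y * indicator (g <# H n) y)"
    by (auto simp: indicator_def)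
  ultimately show ?thesis
    by simp
qed

text \<open>The operator translates its argument on the right only, so a left factor passes through
  it: 1_(gH)(x y^-1) = 1_H(g^-1 x y^-1).\<close>

lemma vt_step_function:
  fixes w :: "'i \<Rightarrow> complex"
  assumes "Re \<alpha> > 0"
  shows "vt \<alpha> (\<lambda>x. \<Sum>i\<in>I. w i * indicator (g i <# H N) x) x =
    (1 - of_nat q powr \<alpha>) / (1 - of_nat q powr (- (\<alpha> + of_nat Q))) *
      (\<Sum>i\<in>I. w i * vt_indicator_integral \<alpha> N (inv g i \<otimes> x))"
proof -
  let ?P = "\<lambda>y. complex_of_real (hnorm y) powr (\<alpha> + of_nat Q)"
  have "has_bochner_integral M (\<lambda>y. \<Sum>i\<in>I. w i *
      ((indicator (H N) (inv g i \<otimes> x \<otimes> inv y) - indicator (H N) (inv g i \<otimes> x)) / ?P y))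
      (\<Sum>i\<in>I. w i * vt_indicator_integral \<alpha> N (inv g i \<otimes> x))"
    by (intro has_bochner_integral_sum has_bochner_integral_mult_right
        has_bochner_integral_vt_indicator assms)
  also have "(\<lambda>y. \<Sum>i\<in>I. w i *
      ((indicator (H N) (inv g i \<otimes> x \<otimes> inv y) - indicator (H N) (inv g i \<otimes> x)) / ?P y)) =
      (\<lambda>y. ((\<Sum>i\<in>I. w i * indicator (g i <# H N) (x \<otimes> inv y)) -
        (\<Sum>i\<in>I. w i * indicator (g i <# H N) x)) / ?P y)"
    by (simp add: indicator_def mem_l_coset_iff m_assoc sum_divide_distrib
        sum_subtractf[symmetric] algebra_simps diff_divide_distrib)
  finally show ?thesis
    by (simp add: vt_def has_bochner_integral_integral_eq)
qed

lemma has_bochner_integral_convolution_step_function: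
  fixes w :: "'i \<Rightarrow> complex"
  assumes \<alpha>: "Re \<alpha> > 0" "Re \<alpha> \<noteq> real Q"
  shows "has_bochner_integral M
    (\<lambda>y. vt \<alpha> (\<lambda>x. \<Sum>i\<in>I. w i * indicator (g i <# H N) x) y *
      ((1 - of_nat q powr (- \<alpha>)) / (1 - of_nat q powr (\<alpha> - of_nat Q)) *
        kern (\<alpha> - of_nat Q) (inv y \<otimes> x)))
    (\<Sum>i\<in>I. w i * indicator (g i <# H N) x)"
proof -
  define c where "c = (1 - of_nat q powr \<alpha>) / (1 - of_nat q powr (- (\<alpha> + of_nat Q)))"
  define d where "d = (1 - of_nat q powr (- \<alpha>)) / (1 - of_nat q powr (\<alpha> - of_nat Q))"
  define z where "z = (1 - 1 / (of_nat q powr \<alpha> * of_real r)) / (1 - of_nat q powr \<alpha>) *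
     ((1 - of_nat q powr \<alpha> / of_real r) / (1 - 1 / of_nat q powr \<alpha>))"
  have neq: "u \<noteq> 1" if "norm u \<noteq> 1" for u :: complex
    using that by auto
  have r_powr: "r = real q powr real Q"
    using q_gt_1 by (simp add: powr_realpow)
  \<comment> \<open>Each modulus is a power of q with nonzero real exponent; for
    \<open>\<alpha> - of_nat Q\<close> this is Re \<alpha> \<noteq> Q.\<close>
  have "of_nat q powr \<alpha> \<noteq> (1::complex)" "of_nat q powr (- \<alpha>) \<noteq> (1::complex)"
    "of_nat q powr (\<alpha> - of_nat Q) \<noteq> (1::complex)" "of_nat q powr (- (\<alpha> + of_nat Q)) \<noteq> (1::complex)"
    using q_gt_1 \<alpha> by (auto intro!: neq simp: norm_q_powr)
  then have cdz: "c * d * z = 1"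
    unfolding c_def d_def z_def q_powr_diff_Q[symmetric] q_powr_minus_add_Q[symmetric]
    by (simp add: powr_minus inverse_eq_divide del: minus_add_distrib of_real_power)
  have "has_bochner_integral M (\<lambda>y. c * d * (\<Sum>i\<in>I. w i * (vt_indicator_integral \<alpha> N (inv g i \<otimes> y) *
        kern (\<alpha> - of_nat Q) (inv (inv g i \<otimes> y) \<otimes> (inv g i \<otimes> x)))))
      (c * d * (\<Sum>i\<in>I. w i * (z * indicator (H N) (inv g i \<otimes> x))))"
    unfolding z_def
    by (intro has_bochner_integral_mult_right has_bochner_integral_sum has_bochner_integral_translate
        has_bochner_integral_convolution_indicator \<alpha>)
  also have "c * d * (\<Sum>i\<in>I. w i * (z * indicator (H N) (inv g i \<otimes> x))) =
      c * d * z * (\<Sum>i\<in>I. w i * indicator (g i <# H N) x)"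
    by (simp add: sum_distrib_left indicator_def mem_l_coset_iff mult_ac)
  also have "\<dots> = (\<Sum>i\<in>I. w i * indicator (g i <# H N) x)"
    by (simp add: cdz)
  also have "(\<lambda>y. c * d * (\<Sum>i\<in>I. w i * (vt_indicator_integral \<alpha> N (inv g i \<otimes> y) *
        kern (\<alpha> - of_nat Q) (inv (inv g i \<otimes> y) \<otimes> (inv g i \<otimes> x))))) =
      (\<lambda>y. vt \<alpha> (\<lambda>x. \<Sum>i\<in>I. w i * indicator (g i <# H N) x) y *
        (d * kern (\<alpha> - of_nat Q) (inv y \<otimes> x)))"
  proof
    fix y
    have "inv (inv h \<otimes> y) \<otimes> (inv h \<otimes> x) = inv y \<otimes> x" for h
    proof -
      have "h \<otimes> (inv h \<otimes> x) = x"
        by (simp add: m_assoc[symmetric])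
      then show ?thesis
        by (simp add: inv_mult_group m_assoc)
    qed
    then show "c * d * (\<Sum>i\<in>I. w i * (vt_indicator_integral \<alpha> N (inv g i \<otimes> y) *
        kern (\<alpha> - of_nat Q) (inv (inv g i \<otimes> y) \<otimes> (inv g i \<otimes> x)))) =
      vt \<alpha> (\<lambda>x. \<Sum>i\<in>I. w i * indicator (g i <# H N) x) y * (d * kern (\<alpha> - of_nat Q) (inv y \<otimes> x))"
      unfolding vt_step_function[OF \<alpha>(1)] c_def[symmetric]
      by (simp add: sum_distrib_left sum_distrib_right mult_ac)
  qed
  finally show ?thesis
    unfolding d_def .
qed

end

section \<open>The grading in coordinates\<close>

context graded_lie_algebra
begin

lemma component_eqI:
  assumes "\<And>k. f k \<in> V k" "finite {k. f k \<noteq> 0}" "x = (\<Sum>k | f k \<noteq> 0. f k)"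
  shows "component x = f"
  unfolding component_def using assms direct_sum[of x] by (intro the1_equality) auto

lemma component_decomposition:
  "component x k \<in> V k" "finite {k. component x k \<noteq> 0}" "(\<Sum>k | component x k \<noteq> 0. component x k) = x"
proof -
  have "(\<forall>k. component x k \<in> V k) \<and> finite {k. component x k \<noteq> 0} \<and> x = (\<Sum>k | component x k \<noteq> 0. component x k)"
    unfolding component_def by (rule theI'[OF direct_sum])
  then show "component x k \<in> V k" "finite {k. component x k \<noteq> 0}" "(\<Sum>k | component x k \<noteq> 0. component x k) = x"
    by auto
qed

lemma component_eqI':
  assumes "\<And>k. f k \<in> V k" "finite S" "\<And>k. k \<notin> S \<Longrightarrow> f k = 0" "x = sum f S"
  shows "component x = f"
proof (rule component_eqI)
  show "finite {k. f k \<noteq> 0}"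
    using assms(2,3) by (rule_tac finite_subset[of _ S]) auto
  show "x = (\<Sum>k | f k \<noteq> 0. f k)"
    unfolding assms(4) using assms(2,3) by (intro sum.mono_neutral_right) auto
qed (rule assms)

lemma component_scale: "component (c *\<^sub>K x) k = c *\<^sub>K component x k"
proof -
  have "component (c *\<^sub>K x) = (\<lambda>k. c *\<^sub>K component x k)"
  proof (rule component_eqI')
    show "c *\<^sub>K x = (\<Sum>k | component x k \<noteq> 0. c *\<^sub>K component x k)"
      by (simp add: component_decomposition(3) flip: scale_sum_right)
  qed (auto intro: subspace_scale subspace_V component_decomposition)
  then show ?thesis
    by simp
qed

lemma component_dilation: "component (dilation c x) k = c ^ k *\<^sub>K component x k"
proof -
  have "component (dilation c x) = (\<lambda>k. c ^ k *\<^sub>K component x k)"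
    by (rule component_eqI'[where S = "{k. component x k \<noteq> 0}"])
      (auto intro: subspace_scale subspace_V component_decomposition simp: dilation_def)
  then show ?thesis
    by simp
qed

lemma component_of_mem: "x \<in> V k \<Longrightarrow> component x = (\<lambda>i. if i = k then x else 0)"
  by (rule component_eqI'[where S = "{k}"]) (auto intro: subspace_0 subspace_V)

end

section \<open>Coordinates in the eigenbasis\<close>

context graded_lie_group_basis
begin

abbreviation coord :: "'g \<Rightarrow> 'g \<Rightarrow> 'k" where
  "coord \<equiv> representation B"

lemma in_span [simp]: "x \<in> span B"
  by (simp add: span_basis)

lemma sum_coord: "(\<Sum>b\<in>B. coord x b *\<^sub>K b) = x"
  by (rule sum_representation_eq) (simp_all add: independent_basis finite_basis)

lemma coord_add [simp]: "coord (x + y) b = coord x b + coord y b"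
  by (simp add: representation_add independent_basis)

lemma coord_diff [simp]: "coord (x - y) b = coord x b - coord y b"
  by (simp add: representation_diff independent_basis)

lemma coord_scale [simp]: "coord (c *\<^sub>K x) b = c * coord x b"
  by (simp add: representation_scale independent_basis)

lemma coord_sum [simp]: "coord (sum f I) b = (\<Sum>i\<in>I. coord (f i) b)"
  by (simp add: representation_sum independent_basis)

lemma coord_0 [simp]: "coord 0 b = 0"
  by (simp add: representation_zero)

lemma coord_basis: "b \<in> B \<Longrightarrow> coord b c = (if c = b then 1 else 0)"
  by (simp add: representation_basis independent_basis)

lemma coord_lincomb:
  assumes "S \<subseteq> B"
  shows "coord (\<Sum>b\<in>S. a b *\<^sub>K b) c = (if c \<in> S then a c else 0)"
proof -
  have "coord (\<Sum>b\<in>S. a b *\<^sub>K b) c = (\<Sum>b\<in>S. if c = b then a b else 0)"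
    using assms by (auto simp: coord_basis intro!: sum.cong)
  then show ?thesis
    using finite_subset[OF assms finite_basis] by simp
qed

lemma vec_eq_iff: "x = y \<longleftrightarrow> (\<forall>b\<in>B. coord x b = coord y b)"
proof
  assume "\<forall>b\<in>B. coord x b = coord y b"
  then have "(\<Sum>b\<in>B. coord x b *\<^sub>K b) = (\<Sum>b\<in>B. coord y b *\<^sub>K b)"
    by (intro sum.cong) auto
  then show "x = y"
    by (simp add: sum_coord)
qed auto

lemma basis_nonzero: "b \<in> B \<Longrightarrow> b \<noteq> 0"
  using coord_basis[of b b] by auto

lemma pi_nonzero [simp]: "\<pi> \<noteq> 0"
  using uniformizer by (simp add: uniformizer_def)

lemma absv_pi_bounds [simp]: "0 < absv \<pi>" "absv \<pi> < 1"
  using uniformizer by (simp_all add: uniformizer_def)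

text \<open>A nonzero component in degree k forces \<pi>^k to be the eigenvalue of
  \<open>dilation \<pi>\<close>. The powers of \<pi> have different absolute values, so only one
  degree can occur.\<close>

lemma basis_homogeneous:
  assumes "b \<in> B"
  shows "\<exists>k. b \<in> V k"
proof -
  obtain c where c: "dilation \<pi> b = c *\<^sub>K b"
    using eigenvector_basis[OF assms] by fastforce
  have eq: "\<pi> ^ k = c" if "component b k \<noteq> 0" for k
    using that component_dilation[of \<pi> b k] component_scale[of c b k] c by simp
  have "k = l" if "component b k \<noteq> 0" "component b l \<noteq> 0" for k l
  proof -
    have "absv \<pi> ^ k = absv \<pi> ^ l"
      using eq[OF that(1)] eq[OF that(2)] by (metis absv_power)
    then show ?thesis
      using absv_pi_bounds power_inject_exp' by (metis less_irrefl order_less_le power_inject_exp')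
  qed
  then obtain k where k: "{k. component b k \<noteq> 0} \<subseteq> {k}"
    by blast
  then have "(\<Sum>k | component b k \<noteq> 0. component b k) = component b k"
    by (subst sum.mono_neutral_left[of "{k}"]) auto
  then show ?thesis
    using component_decomposition(1,3)[of b] by metis
qed

definition weight :: "'g \<Rightarrow> nat" where
  "weight b = (SOME k. b \<in> V k)"

lemma basis_mem_V: "b \<in> B \<Longrightarrow> b \<in> V (weight b)"
  unfolding weight_def using basis_homogeneous by (rule someI_ex)

lemma weight_pos: "b \<in> B \<Longrightarrow> weight b > 0"
  using basis_mem_V[of b] basis_nonzero[of b] V_0 by (cases "weight b") auto

text \<open>Grouping the basis expansion by weight yields a graded decomposition, and such
  decompositions are unique.\<close>

lemma component_eq: "component x k = (\<Sum>b | b \<in> B \<and> weight b = k. coord x b *\<^sub>K b)"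
proof -
  have "component x = (\<lambda>k. \<Sum>b | b \<in> B \<and> weight b = k. coord x b *\<^sub>K b)"
  proof (rule component_eqI')
    show "(\<Sum>b | b \<in> B \<and> weight b = k. coord x b *\<^sub>K b) \<in> V k" for k
      using basis_mem_V by (intro subspace_sum subspace_V subspace_scale) auto
    show "finite (weight ` B)"
      using finite_basis by simp
    show "x = (\<Sum>k\<in>weight ` B. \<Sum>b | b \<in> B \<and> weight b = k. coord x b *\<^sub>K b)"
      using finite_basis by (subst sum.image_gen[symmetric]) (simp_all add: sum_coord)
    show "(\<Sum>b | b \<in> B \<and> weight b = k. coord x b *\<^sub>K b) = 0" if "k \<notin> weight ` B" for k
      using that by (intro sum.neutral) auto
  qed
  then show ?thesis
    by simp
qed

lemma coord_component: "b \<in> B \<Longrightarrow> coord (component x k) b = (if weight b = k then coord x b else 0)"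
  unfolding component_eq by (subst coord_lincomb) auto

lemma coord_eq_0: "x \<in> V k \<Longrightarrow> b \<in> B \<Longrightarrow> weight b \<noteq> k \<Longrightarrow> coord x b = 0"
  using coord_component[of b x k] by (simp add: component_of_mem)

lemma coord_dilation: "b \<in> B \<Longrightarrow> coord (dilation c x) b = c ^ weight b * coord x b"
  using coord_component[of b "dilation c x" "weight b"] coord_component[of b x "weight b"]
  by (simp add: component_dilation)

lemma V_eq_span: "V k = span {b \<in> B. weight b = k}"
proof (intro equalityI subsetI)
  fix x
  assume "x \<in> V k"
  then have "x = component x k"
    by (simp add: component_of_mem)
  also have "\<dots> \<in> span {b \<in> B. weight b = k}"
    unfolding component_eq by (intro span_sum span_scale span_base) auto
  finally show "x \<in> span {b \<in> B. weight b = k}" .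
next
  fix x
  assume "x \<in> span {b \<in> B. weight b = k}"
  then show "x \<in> V k"
    using span_minimal[OF _ subspace_V, of "{b \<in> B. weight b = k}" k] basis_mem_V by blast
qed

text \<open>The basis vectors of weight k form a basis of \<open>V k\<close>, so each contributes
  its weight once. In this form Q matches the count of digits per coordinate.\<close>

lemma homogeneous_dim_eq: "homogeneous_dim = (\<Sum>b\<in>B. weight b)"
proof -
  have "dim (V k) = card {b \<in> B. weight b = k}" for k
  proof -
    have "independent {b \<in> B. weight b = k}"
      by (rule independent_mono[OF independent_basis]) blast
    then show ?thesis
      by (subst V_eq_span) (rule dim_span_eq_card_independent)
  qed
  moreover have "{k. V k \<noteq> {0}} = weight ` B"
  proof (intro equalityI subsetI)
    fix k
    assume k: "k \<in> {k. V k \<noteq> {0}}"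
    show "k \<in> weight ` B"
    proof (rule ccontr)
      assume "k \<notin> weight ` B"
      then have "V k = span {}"
        by (subst V_eq_span) (rule arg_cong[of _ _ span], auto)
      with k show False
        by simp
    qed
  qed (use basis_mem_V basis_nonzero in blast)
  ultimately have "homogeneous_dim = (\<Sum>k\<in>weight ` B. \<Sum>b | b \<in> B \<and> weight b = k. weight b)"
    by (simp add: homogeneous_dim_def mult.commute)
  also have "\<dots> = (\<Sum>b\<in>B. weight b)"
    using finite_basis by (rule sum.image_gen[symmetric])
  finally show ?thesis .
qed

text \<open>The lattice is the unit box in coordinates and dilation scales coordinate b by a power
  of \<pi> proportional to its weight; hence an anisotropic box.\<close>

lemma G_sub_iff: "x \<in> G_sub n \<longleftrightarrow> (\<forall>b\<in>B. absv (coord x b) \<le> absv \<pi> powi (n * int (weight b)))"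
proof -
  have lattice_iff: "y \<in> lattice \<longleftrightarrow> (\<forall>b\<in>B. absv (coord y b) \<le> 1)" for y
  proof
    assume "y \<in> lattice"
    then show "\<forall>b\<in>B. absv (coord y b) \<le> 1"
      by (auto simp: lattice_def integer_ring_def coord_lincomb simp del: coord_sum)
  next
    assume "\<forall>b\<in>B. absv (coord y b) \<le> 1"
    then show "y \<in> lattice"
      unfolding lattice_def using sum_coord[of y]
      by (intro CollectI exI[of _ "coord y"]) (auto simp: integer_ring_def)
  qed
  have scaled: "absv ((\<pi> powi n) ^ weight b * c) \<le> absv \<pi> powi (n * int (weight b)) \<longleftrightarrow> absv c \<le> 1" for b c
    using mult_le_cancel_left_pos[of "(absv \<pi> powi n) ^ weight b" "absv c" 1]
    by (simp add: absv_mult power_int_mult)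
  show ?thesis
  proof
    assume "x \<in> G_sub n"
    then show "\<forall>b\<in>B. absv (coord x b) \<le> absv \<pi> powi (n * int (weight b))"
      by (auto simp: G_sub_def lattice_iff coord_dilation scaled)
  next
    assume *: "\<forall>b\<in>B. absv (coord x b) \<le> absv \<pi> powi (n * int (weight b))"
    define y where "y = (\<Sum>b\<in>B. (coord x b / (\<pi> powi n) ^ weight b) *\<^sub>K b)"
    have xy: "x = dilation (\<pi> powi n) y"
      by (simp add: vec_eq_iff coord_dilation y_def coord_lincomb del: coord_sum)
    then have "y \<in> lattice"
      using * by (simp add: coord_dilation scaled lattice_iff)
    with xy show "x \<in> G_sub n"
      by (auto simp: G_sub_def)
  qed
qed

end

section \<open>The index of consecutive dilates\<close>

context lie_algebra
begin

lemma bracket_0_left [simp]: "bracket 0 y = 0"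
  using bracket_scale_left[of 0 0 y] by simp

lemma bracket_0_right [simp]: "bracket y 0 = 0"
  using bracket_scale_right[of y 0 0] by simp

lemma bracket_sum_left: "bracket (sum f I) y = (\<Sum>i\<in>I. bracket (f i) y)"
  by (induction I rule: infinite_finite_induct) (simp_all add: bracket_add_left)

lemma bracket_sum_right: "bracket y (sum f I) = (\<Sum>i\<in>I. bracket y (f i))"
  by (induction I rule: infinite_finite_induct) (simp_all add: bracket_add_right)

lemma length_dynkin_word:
  "length (concat (map (\<lambda>(r, s). replicate r x @ replicate s y) rs)) = (\<Sum>(r, s)\<leftarrow>rs. r + s)"
  by (induction rs) auto

lemma set_dynkin_word:
  "set (concat (map (\<lambda>(r, s). replicate r x @ replicate s y) rs)) \<subseteq> {x, y}"
  using [[simproc del: list_to_set_comprehension]] by (auto simp: in_set_replicate)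

lemma dynkin_exponents_1: "dynkin_exponents 1 = {[(1, 0)], [(0, 1)]}"
proof (intro equalityI subsetI)
  fix rs
  assume "rs \<in> dynkin_exponents 1"
  then have rs: "rs \<noteq> []" "\<forall>(r, s)\<in>set rs. r + s > 0" "(\<Sum>(r, s)\<leftarrow>rs. r + s) = 1"
    by (auto simp: dynkin_exponents_def)
  obtain r s rs' where eq: "rs = (r, s) # rs'"
    using rs(1) by (cases rs) auto
  have "rs' = []"
  proof (cases rs')
    case (Cons p ps)
    then show ?thesis
      using rs eq by (cases p) auto
  qed
  with rs eq show "rs \<in> {[(1, 0)], [(0, 1)]}"
    by auto
qed (auto simp: dynkin_exponents_def)

lemma sum_dynkin_terms_1: "(\<Sum>rs\<in>dynkin_exponents 1. dynkin_term x y rs) = x + y"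
  unfolding dynkin_exponents_1 by (simp add: dynkin_term_def)

end

section \<open>The filtration by weight\<close>

context graded_lie_group_basis
begin

lemma bracket_expand:
  "bracket x y = (\<Sum>b\<in>B. \<Sum>c\<in>B. (coord x b * coord y c) *\<^sub>K bracket b c)"
proof -
  have "bracket x y = bracket (\<Sum>b\<in>B. coord x b *\<^sub>K b) (\<Sum>c\<in>B. coord y c *\<^sub>K c)"
    by (simp add: sum_coord)
  also have "\<dots> = (\<Sum>b\<in>B. \<Sum>c\<in>B. (coord x b * coord y c) *\<^sub>K bracket b c)"
    by (simp add: bracket_sum_left bracket_sum_right bracket_scale_left bracket_scale_right
        scale_sum_right, subst sum.swap) (simp add: mult.commute)
  finally show ?thesis .
qed

definition filt :: "nat \<Rightarrow> 'g set" where
  "filt j = {x. \<forall>b\<in>B. weight b < j \<longrightarrow> coord x b = 0}"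

lemma subspace_filt: "subspace (filt j)"
  by (auto simp: subspace_def filt_def)

lemma filt_antimono: "i \<le> j \<Longrightarrow> filt j \<subseteq> filt i"
  by (auto simp: filt_def)

lemma filt_1: "filt 1 = UNIV"
proof -
  have "\<not> weight b < 1" if "b \<in> B" for b
    using weight_pos[OF that] by simp
  then show ?thesis
    unfolding filt_def by blast
qed

text \<open>In the expansion over the basis a term either has a vanishing coefficient or is a
  bracket of vectors whose weights add up to at least i + j.\<close>

lemma bracket_filt:
  assumes "x \<in> filt i" "y \<in> filt j"
  shows "bracket x y \<in> filt (i + j)"
proof (subst bracket_expand, intro subspace_sum subspace_filt)
  fix b c
  assume bc: "b \<in> B" "c \<in> B"
  show "(coord x b * coord y c) *\<^sub>K bracket b c \<in> filt (i + j)"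
  proof (cases "weight b < i \<or> weight c < j")
    case True
    then have "coord x b = 0 \<or> coord y c = 0"
      using assms bc unfolding filt_def by blast
    then show ?thesis
      using subspace_0[OF subspace_filt] by auto
  next
    case False
    have V: "bracket b c \<in> V (weight b + weight c)"
      using bc by (intro bracket_V basis_mem_V)
    have "coord (bracket b c) d = 0" if "d \<in> B" "weight d < i + j" for d
      using that False by (intro coord_eq_0[OF V]) auto
    then have "bracket b c \<in> filt (i + j)"
      by (simp add: filt_def)
    then show ?thesis
      by (rule subspace_scale[OF subspace_filt])
  qed
qed

lemma nested_bracket_filt:
  "xs \<noteq> [] \<Longrightarrow> set xs \<subseteq> filt j \<Longrightarrow> nested_bracket xs \<in> filt (length xs * j)"
proof (induction xs rule: nested_bracket.induct)
  case (3 x y zs)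
  then have "bracket x (nested_bracket (y # zs)) \<in> filt (j + length (y # zs) * j)"
    by (intro bracket_filt) auto
  then show ?case
    by (simp add: algebra_simps)
qed auto

text \<open>The word of an exponent list of degree d has d letters, each contributing weight at
  least j to the nested bracket.\<close>

lemma dynkin_term_filt:
  assumes "rs \<in> dynkin_exponents d" "d \<ge> 1" "x \<in> filt j" "y \<in> filt j"
  shows "dynkin_term x y rs \<in> filt (d * j)"
proof -
  define w where "w = concat (map (\<lambda>(r, s). replicate r x @ replicate s y) rs)"
  have len: "length w = d"
    using assms(1) unfolding w_def length_dynkin_word by (simp add: dynkin_exponents_def)
  then have "w \<noteq> []"
    using assms(2) by auto
  moreover have "set w \<subseteq> filt j"
    using set_dynkin_word[of x y rs] assms(3,4) unfolding w_def by blast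
  ultimately have "nested_bracket w \<in> filt (d * j)"
    using nested_bracket_filt[of w j] len by simp
  then show ?thesis
    unfolding dynkin_term_def w_def by (rule subspace_scale[OF subspace_filt])
qed

end

section \<open>The group law modulo deeper weights, and coset representatives\<close>

context graded_lie_group
begin

abbreviation mult (infixl "\<odot>" 70) where
  "x \<odot> y \<equiv> x \<otimes>\<^bsub>exp_group\<^esub> y"

interpretation G: group exp_group
  by (rule group_exp)

lemma carrier_exp_group [simp]: "carrier exp_group = UNIV"
  by (simp add: exp_group_def)

lemma one_exp_group [simp]: "\<one>\<^bsub>exp_group\<^esub> = 0"
  by (simp add: exp_group_def)

lemma mult_eq_bch: "x \<odot> y = bch x y"
  by (simp add: exp_group_def)

lemma inv_mult_cancel:
  "inv\<^bsub>exp_group\<^esub> x \<odot> (x \<odot> y) = y" "x \<odot> (inv\<^bsub>exp_group\<^esub> x \<odot> y) = y"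
  by (simp_all add: G.m_assoc[symmetric] del: one_exp_group)

text \<open>With class 0 the sum defining \<open>bch\<close> would be empty and the linear term x +
  y would be lost; a nonzero vector excludes this.\<close>

lemma nilpotency_class_pos: "nilpotency_class \<ge> 1"
proof -
  have "lower_central nilpotency_class = {0}"
    using nilpotent unfolding nilpotent_def nilpotency_class_def by (rule LeastI_ex)
  moreover have "lower_central 0 \<noteq> {0}"
    using nontrivial by auto
  ultimately have "nilpotency_class \<noteq> 0"
    by metis
  then show ?thesis
    by simp
qed

text \<open>All terms of degree at least two lie deeper in the filtration, so that only \<open>x + y\<close> survives
  on the first graded piece.\<close>
lemma mult_filt:
  assumes "j \<ge> 1" "x \<in> filt j" "y \<in> filt j"
  shows "x \<odot> y - (x + y) \<in> filt (Suc j)"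
proof -
  have "bch x y = (x + y) + (\<Sum>d = 2..nilpotency_class. \<Sum>rs\<in>dynkin_exponents d. dynkin_term x y rs)"
    unfolding bch_def
    using nilpotency_class_pos sum_dynkin_terms_1[of x y] by (simp add: sum.atLeast_Suc_atMost numeral_2_eq_2)
  moreover have "(\<Sum>d = 2..nilpotency_class. \<Sum>rs\<in>dynkin_exponents d. dynkin_term x y rs) \<in> filt (Suc j)"
  proof (intro subspace_sum subspace_filt)
    fix d rs
    assume d: "d \<in> {2..nilpotency_class}" "rs \<in> dynkin_exponents d"
    then have "dynkin_term x y rs \<in> filt (d * j)"
      using assms by (intro dynkin_term_filt) auto
    moreover have "Suc j \<le> 2 * j" "2 * j \<le> d * j"
      using assms(1) d(1) by auto
    then have "filt (d * j) \<subseteq> filt (Suc j)"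
      by (intro filt_antimono) linarith
    ultimately show "dynkin_term x y rs \<in> filt (Suc j)"
      by blast
  qed
  ultimately show ?thesis
    by (simp add: mult_eq_bch)
qed

lemma coord_mult_filt:
  assumes "j \<ge> 1" "x \<in> filt j" "y \<in> filt j" "b \<in> B" "weight b \<le> j"
  shows "coord (x \<odot> y) b = coord x b + coord y b"
proof -
  have "weight b < Suc j"
    using assms(5) by simp
  then have "coord (x \<odot> y - (x + y)) b = 0"
    using mult_filt[OF assms(1-3)] assms(4) unfolding filt_def by blast
  then show ?thesis
    by simp
qed

lemma mult_mem_filt:
  assumes "j \<ge> 1" "x \<in> filt j" "y \<in> filt j"
  shows "x \<odot> y \<in> filt j"
  unfolding filt_def
proof (intro CollectI ballI impI)
  fix b
  assume b: "b \<in> B" "weight b < j"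
  then have "coord x b = 0" "coord y b = 0"
    using assms(2,3) by (auto simp: filt_def)
  then show "coord (x \<odot> y) b = 0"
    using coord_mult_filt[OF assms b(1)] b(2) by simp
qed

text \<open>Induction on the depth: once both elements lie in \<open>filt j\<close>, coordinates of
  weight at most j add up to those of the product 0, so they vanish for the inverse whenever they
  vanish for \<open>x\<close>.\<close>

lemma inv_mem_filt:
  assumes "1 \<le> j" "x \<in> filt j"
  shows "inv\<^bsub>exp_group\<^esub> x \<in> filt j"
  using assms
proof (induction j rule: dec_induct)
  case base
  show ?case
    unfolding filt_1 ..
next
  case (step j)
  let ?z = "inv\<^bsub>exp_group\<^esub> x"
  have x: "x \<in> filt j"
    using step.prems filt_antimono[of j "Suc j"] by auto
  then have z: "?z \<in> filt j"
    by (rule step.IH)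
  have "coord ?z b = 0" if "b \<in> B" "weight b \<le> j" for b
  proof -
    have "coord (x \<odot> ?z) b = coord x b + coord ?z b"
      using x z that step.hyps by (intro coord_mult_filt)
    moreover have "x \<odot> ?z = 0"
      using G.r_inv[of x] by simp
    moreover have "coord x b = 0"
      using step.prems that by (simp add: filt_def)
    ultimately show ?thesis
      by simp
  qed
  then show ?case
    by (simp add: filt_def)
qed

lemmas G_sub_closed = subgroup.m_closed[OF subgroup_G_sub] subgroup.m_inv_closed[OF subgroup_G_sub]

lemma zero_mem_G_sub: "0 \<in> G_sub n"
  using subgroup.one_closed[OF subgroup_G_sub] by simp

lemma G_sub_Suc_subset: "G_sub (n + 1) \<subseteq> G_sub n"
proof
  fix x
  assume x: "x \<in> G_sub (n + 1)"
  show "x \<in> G_sub n"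
    unfolding G_sub_iff
  proof
    fix b
    assume b: "b \<in> B"
    have "absv \<pi> powi ((n + 1) * int (weight b)) = absv \<pi> powi (n * int (weight b)) * absv \<pi> ^ weight b"
      by (simp add: distrib_right power_int_add)
    also have "\<dots> \<le> absv \<pi> powi (n * int (weight b))"
      using power_le_one[of "absv \<pi>" "weight b"] by (simp add: mult_le_cancel_left1 less_imp_le)
    finally show "absv (coord x b) \<le> absv \<pi> powi (n * int (weight b))"
      using x b unfolding G_sub_iff by force
  qed
qed

text \<open>The sum of all weights serves as a bound for each of them and gives the downward
  induction its starting point.\<close>

lemma filt_eventually_trivial: "filt (Suc (\<Sum>b\<in>B. weight b)) = {0}"
proof -
  have "weight b < Suc (\<Sum>b\<in>B. weight b)" if "b \<in> B" for b
    using member_le_sum[OF that _ finite_basis, of weight] by simp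
  then show ?thesis
    by (auto simp: filt_def vec_eq_iff)
qed

text \<open>Downward induction on j. Passing from G_n to G_(n+1) shrinks a coordinate of weight j by
  \<pi>^j, hence q^j choices for each. A representative is \<open>\<sigma> a \<odot> t\<close>:
  \<open>a\<close> prescribes the coordinates of weight j, and \<open>t\<close> comes from the
  transversal one level deeper.\<close>

lemma ex_transversal_filt:
  fixes n :: int
  assumes "1 \<le> j" "j \<le> Suc (\<Sum>b\<in>B. weight b)"
  shows "\<exists>R. finite R \<and> card R = residue_card TYPE('k) ^ (\<Sum>b | b \<in> B \<and> j \<le> weight b. weight b) \<and>
    R \<subseteq> G_sub n \<inter> filt j \<and>
    (\<forall>x \<in> G_sub n \<inter> filt j. \<exists>!r. r \<in> R \<and> inv\<^bsub>exp_group\<^esub> r \<odot> x \<in> G_sub (n + 1))"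
  using assms(2,1)
proof (induction j rule: inc_induct)
  case base
  have "{b \<in> B. Suc (\<Sum>b\<in>B. weight b) \<le> weight b} = {}"
  proof (rule ccontr)
    assume "{b \<in> B. Suc (\<Sum>b\<in>B. weight b) \<le> weight b} \<noteq> {}"
    then obtain b where b: "b \<in> B" "Suc (\<Sum>b\<in>B. weight b) \<le> weight b"
      by blast
    then show False
      using member_le_sum[OF b(1) _ finite_basis, of weight] by simp
  qed
  then have "(\<Sum>b | b \<in> B \<and> Suc (\<Sum>b\<in>B. weight b) \<le> weight b. weight b) = 0"
    by (simp only: sum.empty)
  then show ?case
    unfolding filt_eventually_trivial
    using G.inv_one by (intro exI[of _ "{0}"]) (auto simp: zero_mem_G_sub G_sub_closed)
next
  case (step j)
  let ?q = "residue_card TYPE('k)"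
  obtain R where R: "finite R" "card R = ?q ^ (\<Sum>b | b \<in> B \<and> Suc j \<le> weight b. weight b)"
    "R \<subseteq> G_sub n \<inter> filt (Suc j)"
    "\<And>x. x \<in> G_sub n \<inter> filt (Suc j) \<Longrightarrow> \<exists>!r. r \<in> R \<and> inv\<^bsub>exp_group\<^esub> r \<odot> x \<in> G_sub (n + 1)"
    using step.IH by auto
  obtain T :: "'k set" where T: "finite T" "card T = ?q ^ j" "\<forall>t\<in>T. absv t \<le> absv \<pi> powi (n * int j)"
    "\<forall>x. absv x \<le> absv \<pi> powi (n * int j) \<longrightarrow>
      (\<exists>!t. t \<in> T \<and> absv (x - t) \<le> absv \<pi> powi (n * int j + int j))"
    using ex_fractional_transversal[OF uniformizer, of j "n * int j"] by blast
  have nj: "n * int j + int j = (n + 1) * int j"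
    by (simp add: algebra_simps)
  define Bj where "Bj = {b \<in> B. weight b = j}"
  have Bj: "Bj \<subseteq> B" "finite Bj"
    using finite_basis by (auto simp: Bj_def)
  define \<sigma> where "\<sigma> a = (\<Sum>b\<in>Bj. a b *\<^sub>K b)" for a :: "'g \<Rightarrow> 'k"
  have coord_\<sigma>: "coord (\<sigma> a) b = (if b \<in> Bj then a b else 0)" for a b
    unfolding \<sigma>_def by (rule coord_lincomb[OF Bj(1)])
  have \<sigma>_filt: "\<sigma> a \<in> filt j" for a
    by (auto simp: filt_def coord_\<sigma> Bj_def)
  have \<sigma>_G: "\<sigma> a \<in> G_sub m" if "\<And>b. b \<in> Bj \<Longrightarrow> absv (a b) \<le> absv \<pi> powi (m * int j)" for a m
    using that by (auto simp: G_sub_iff coord_\<sigma> Bj_def)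
  define A where "A = (Bj \<rightarrow>\<^sub>E T) \<times> R"
  define f where "f = (\<lambda>(a, t). \<sigma> a \<odot> t)"
  have filt_Suc: "filt (Suc j) \<subseteq> filt j"
    by (rule filt_antimono) simp
  have f_mem: "f p \<in> G_sub n \<inter> filt j" if pA: "p \<in> A" for p
  proof -
    obtain a t where p: "p = (a, t)" "a \<in> Bj \<rightarrow>\<^sub>E T" "t \<in> R"
      using pA by (auto simp: A_def)
    have "\<sigma> a \<in> G_sub n"
      using p(2) T(3) by (intro \<sigma>_G) auto
    then show ?thesis
      using p R(3) filt_Suc \<sigma>_filt step.prems
      by (auto simp: f_def intro!: G_sub_closed mult_mem_filt)
  qed
  have coord_factor: "coord x b = coord u b + coord (inv\<^bsub>exp_group\<^esub> u \<odot> x) b"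
    if "u \<in> filt j" "x \<in> filt j" "b \<in> Bj" for u x b
  proof -
    have "x = u \<odot> (inv\<^bsub>exp_group\<^esub> u \<odot> x)"
      by (simp add: G.m_assoc[symmetric] del: one_exp_group)
    then have "coord x b = coord (u \<odot> (inv\<^bsub>exp_group\<^esub> u \<odot> x)) b"
      by simp
    also have "\<dots> = coord u b + coord (inv\<^bsub>exp_group\<^esub> u \<odot> x) b"
      using that step.prems
      by (intro coord_mult_filt[of j] mult_mem_filt inv_mem_filt) (auto simp: Bj_def)
    finally show ?thesis .
  qed
  have coord_f: "coord (f (a, t)) b = a b" if "t \<in> R" "b \<in> Bj" for a t b
  proof -
    have "t \<in> filt (Suc j)"
      using that R(3) by blast
    then have "coord t b = 0" "t \<in> filt j"
      using that filt_Suc by (auto simp: filt_def Bj_def)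
    then show ?thesis
      using that step.prems \<sigma>_filt coord_mult_filt[of j "\<sigma> a" t b]
      by (simp add: f_def coord_\<sigma> Bj_def)
  qed
  \<comment> \<open>If \<open>f (a, t)\<close> represents \<open>x\<close>, then \<open>a\<close>
    approximates the weight-j coordinates of \<open>x\<close> to the radius at which elements of
    \<open>T\<close> are distinguished. This determines \<open>a\<close>.\<close>
  have approx: "absv (coord x b - a b) \<le> absv \<pi> powi ((n + 1) * int j)"
    if "x \<in> filt j" "(a, t) \<in> A" "inv\<^bsub>exp_group\<^esub> (f (a, t)) \<odot> x \<in> G_sub (n + 1)" "b \<in> Bj" for x a t b
  proof -
    have "coord x b - a b = coord (inv\<^bsub>exp_group\<^esub> (f (a, t)) \<odot> x) b"
      using coord_factor[of "f (a, t)" x b] f_mem[OF that(2)] that coord_f[of t b a] by (auto simp: A_def)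
    then show ?thesis
      using that(3,4) unfolding G_sub_iff by (auto simp: Bj_def)
  qed
  have ex1: "\<exists>!p. p \<in> A \<and> inv\<^bsub>exp_group\<^esub> (f p) \<odot> x \<in> G_sub (n + 1)" if x: "x \<in> G_sub n \<inter> filt j" for x
  proof (rule ex_ex1I)
    have "\<exists>t. t \<in> T \<and> absv (coord x b - t) \<le> absv \<pi> powi ((n + 1) * int j)" if "b \<in> Bj" for b
    proof -
      have "absv (coord x b) \<le> absv \<pi> powi (n * int j)"
        using x that by (auto simp: G_sub_iff Bj_def)
      then show ?thesis
        using T(4) unfolding nj by blast
    qed
    then obtain a0 where a0: "\<And>b. b \<in> Bj \<Longrightarrow> a0 b \<in> T \<and> absv (coord x b - a0 b) \<le> absv \<pi> powi ((n + 1) * int j)"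
      by metis
    define a where "a = restrict a0 Bj"
    have a: "a \<in> Bj \<rightarrow>\<^sub>E T" "\<And>b. b \<in> Bj \<Longrightarrow> absv (coord x b - a b) \<le> absv \<pi> powi ((n + 1) * int j)"
      using a0 by (auto simp: a_def)
    have \<sigma>a: "\<sigma> a \<in> G_sub n"
      using a(1) T(3) by (intro \<sigma>_G) auto
    define y where "y = inv\<^bsub>exp_group\<^esub> (\<sigma> a) \<odot> x"
    have y: "y \<in> G_sub n" "y \<in> filt j"
      using x \<sigma>a \<sigma>_filt step.prems
      by (auto simp: y_def intro!: G_sub_closed mult_mem_filt inv_mem_filt)
    have y_small: "absv (coord y b) \<le> absv \<pi> powi ((n + 1) * int j)" if "b \<in> Bj" for b
      using coord_factor[of "\<sigma> a" x b] x that a(2)[OF that] \<sigma>_filt by (simp add: y_def coord_\<sigma>)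
    \<comment> \<open>The weight-j coordinates of \<open>y\<close> are small but not zero, so
      \<open>y\<close> need not lie in \<open>filt (Suc j)\<close>. The element \<open>k\<close>
      carries exactly these coordinates and belongs to \<open>G_sub (n + 1)\<close>; dividing by it
      on the right makes the induction hypothesis applicable, and it is absorbed at the end.\<close>
    define k where "k = \<sigma> (coord y)"
    have k: "k \<in> G_sub (n + 1)" "k \<in> filt j"
      using y_small \<sigma>_filt by (auto simp: k_def intro!: \<sigma>_G)
    define z where "z = y \<odot> inv\<^bsub>exp_group\<^esub> k"
    have yzk: "y = z \<odot> k"
      by (simp add: z_def G.m_assoc del: one_exp_group)
    have z: "z \<in> G_sub n" "z \<in> filt j"
      using y k G_sub_Suc_subset step.prems
      by (auto simp: z_def intro!: G_sub_closed mult_mem_filt inv_mem_filt)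
    have "coord z b = 0" if "b \<in> Bj" for b
    proof -
      have "coord y b = coord z b + coord k b"
        by (subst yzk, rule coord_mult_filt[of j]) (use z k step.prems that in \<open>auto simp: Bj_def\<close>)
      then show ?thesis
        using that by (simp add: k_def coord_\<sigma>)
    qed
    then have "z \<in> filt (Suc j)"
      using z(2) by (auto simp: filt_def Bj_def less_Suc_eq)
    then obtain t where t: "t \<in> R" "inv\<^bsub>exp_group\<^esub> t \<odot> z \<in> G_sub (n + 1)"
      using R(4)[of z] z(1) by blast
    have "inv\<^bsub>exp_group\<^esub> (f (a, t)) \<odot> x = inv\<^bsub>exp_group\<^esub> t \<odot> z \<odot> k"
      using yzk unfolding f_def y_def by (simp add: G.inv_mult_group G.m_assoc)
    also have "\<dots> \<in> G_sub (n + 1)"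
      by (rule G_sub_closed(1)[OF t(2) k(1)])
    finally show "\<exists>p. p \<in> A \<and> inv\<^bsub>exp_group\<^esub> (f p) \<odot> x \<in> G_sub (n + 1)"
      using a(1) t(1) by (auto simp: A_def)
  next
    fix p p'
    assume p: "p \<in> A \<and> inv\<^bsub>exp_group\<^esub> (f p) \<odot> x \<in> G_sub (n + 1)"
      "p' \<in> A \<and> inv\<^bsub>exp_group\<^esub> (f p') \<odot> x \<in> G_sub (n + 1)"
    obtain a t a' t' where at: "p = (a, t)" "p' = (a', t')"
      by (cases p, cases p') auto
    have A: "a \<in> Bj \<rightarrow>\<^sub>E T" "a' \<in> Bj \<rightarrow>\<^sub>E T" "t \<in> R" "t' \<in> R"
      using p at by (auto simp: A_def)
    have "a b = a' b" if b: "b \<in> Bj" for b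
    proof -
      have "absv (coord x b) \<le> absv \<pi> powi (n * int j)"
        using x b by (auto simp: G_sub_iff Bj_def)
      then have "\<exists>!t. t \<in> T \<and> absv (coord x b - t) \<le> absv \<pi> powi ((n + 1) * int j)"
        using T(4) unfolding nj by simp
      then show ?thesis
        by (rule ex1_unique) (use A b p at x approx[of x _ _ b] in auto)
    qed
    then have "a = a'"
      using A by (intro PiE_ext[of _ Bj "\<lambda>_. T"]) auto
    let ?h = "inv\<^bsub>exp_group\<^esub> (f (a, t)) \<odot> x" and ?h' = "inv\<^bsub>exp_group\<^esub> (f (a, t')) \<odot> x"
    \<comment> \<open>In this product \<open>x\<close> and \<open>\<sigma> a\<close> cancel. What
      remains says that \<open>t'\<close> represents \<open>t\<close>, as \<open>t\<close> itself
      does, so uniqueness one level deeper applies.\<close>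
    have "?h' \<odot> inv\<^bsub>exp_group\<^esub> ?h \<in> G_sub (n + 1)"
      by (rule G_sub_closed(1), use p at \<open>a = a'\<close> in simp, rule G_sub_closed(2), use p at in simp)
    also have "?h' \<odot> inv\<^bsub>exp_group\<^esub> ?h = inv\<^bsub>exp_group\<^esub> t' \<odot> t"
      by (simp add: f_def G.inv_mult_group G.m_assoc inv_mult_cancel)
    finally have t't: "inv\<^bsub>exp_group\<^esub> t' \<odot> t \<in> G_sub (n + 1)" .
    have "inv\<^bsub>exp_group\<^esub> t \<odot> t \<in> G_sub (n + 1)"
      by (simp add: zero_mem_G_sub)
    moreover have "t \<in> G_sub n \<inter> filt (Suc j)"
      using A R(3) by blast
    ultimately have "t = t'"
      using ex1_unique[OF R(4)[of t], of t t'] A t't by blast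
    then show "p = p'"
      using at \<open>a = a'\<close> by simp
  qed
  have refl: "inv\<^bsub>exp_group\<^esub> x \<odot> x \<in> G_sub (n + 1)" for x
    by (simp add: zero_mem_G_sub)
  have image: "f ` A \<subseteq> G_sub n \<inter> filt j"
    using f_mem by blast
  note trans = transversal_image[where X = "G_sub n \<inter> filt j" and A = A and f = f and
      P = "\<lambda>r x. inv\<^bsub>exp_group\<^esub> r \<odot> x \<in> G_sub (n + 1)", OF ex1 image refl]
  have "card (f ` A) = card A"
    by (rule card_image[OF trans(1)])
  also have "\<dots> = (?q ^ j) ^ card Bj * ?q ^ (\<Sum>b | b \<in> B \<and> Suc j \<le> weight b. weight b)"
    using Bj by (simp add: A_def card_cartesian_product card_PiE R(2) T(2))
  also have "\<dots> = ?q ^ ((\<Sum>b\<in>Bj. weight b) + (\<Sum>b | b \<in> B \<and> Suc j \<le> weight b. weight b))"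
    by (simp add: Bj_def power_add power_mult[symmetric] mult.commute)
  also have "(\<Sum>b\<in>Bj. weight b) + (\<Sum>b | b \<in> B \<and> Suc j \<le> weight b. weight b) =
      (\<Sum>b | b \<in> B \<and> j \<le> weight b. weight b)"
    using finite_basis
    by (subst sum.union_disjoint[symmetric]) (auto simp: Bj_def intro!: sum.cong)
  finally have card: "card (f ` A) = ?q ^ (\<Sum>b | b \<in> B \<and> j \<le> weight b. weight b)" .
  have "finite A"
    using Bj R T by (auto simp: A_def intro!: finite_PiE)
  then show ?case
    using card image trans(2) by (intro exI[of _ "f ` A"]) auto
qed

text \<open>The case j = 1: positive weights make \<open>filt 1\<close> the whole algebra, and the
  exponent is the sum of all weights.\<close>

lemma G_sub_transversal:
  "\<exists>R. finite R \<and> card R = residue_card TYPE('k) ^ homogeneous_dim \<and>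
    G_sub n = (\<Union>g\<in>R. g <#\<^bsub>exp_group\<^esub> G_sub (n + 1)) \<and>
    disjoint_family_on (\<lambda>g. g <#\<^bsub>exp_group\<^esub> G_sub (n + 1)) R"
proof -
  note mem_l_coset = G.mem_l_coset_iff_inv[OF carrier_exp_group]
  have "{b \<in> B. 1 \<le> weight b} = B"
    using weight_pos by force
  then obtain R where R: "finite R" "card R = residue_card TYPE('k) ^ homogeneous_dim" "R \<subseteq> G_sub n"
    "\<And>x. x \<in> G_sub n \<Longrightarrow> \<exists>!r. r \<in> R \<and> inv\<^bsub>exp_group\<^esub> r \<odot> x \<in> G_sub (n + 1)"
    using ex_transversal_filt[of 1 n] unfolding filt_1 homogeneous_dim_eq by auto
  have sub: "g <#\<^bsub>exp_group\<^esub> G_sub (n + 1) \<subseteq> G_sub n" if "g \<in> R" for g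
    using that R(3) G_sub_Suc_subset[of n] by (auto simp: l_coset_def intro!: G_sub_closed)
  have "G_sub n = (\<Union>g\<in>R. g <#\<^bsub>exp_group\<^esub> G_sub (n + 1))"
    using sub R(4) by (fastforce simp: mem_l_coset)
  moreover have "disjoint_family_on (\<lambda>g. g <#\<^bsub>exp_group\<^esub> G_sub (n + 1)) R"
    unfolding disjoint_family_on_def
  proof (intro ballI impI equals0I)
    fix g h x
    assume gh: "g \<in> R" "h \<in> R" "g \<noteq> h"
      and x: "x \<in> (g <#\<^bsub>exp_group\<^esub> G_sub (n + 1)) \<inter> (h <#\<^bsub>exp_group\<^esub> G_sub (n + 1))"
    then have "x \<in> G_sub n"
      using sub by blast
    then have "g = h"
      using ex1_unique[OF R(4)[of x], of g h] gh x by (simp add: mem_l_coset)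
    with gh show False
      by simp
  qed
  ultimately show ?thesis
    using R by blast
qed

end

section \<open>The group topology\<close>

context graded_lie_group_basis
begin

definition coord_ball :: "real \<Rightarrow> 'g set" where
  "coord_ball e = {x. \<forall>b\<in>B. absv (coord x b) \<le> e}"

lemma coord_ball_mono: "x \<in> coord_ball d \<Longrightarrow> d \<le> e \<Longrightarrow> x \<in> coord_ball e"
  unfolding coord_ball_def using order_trans by blast

lemma coord_ball_add: "x \<in> coord_ball e \<Longrightarrow> y \<in> coord_ball e \<Longrightarrow> x + y \<in> coord_ball e"
  by (simp add: coord_ball_def absv_add_le)

lemma zero_mem_coord_ball: "0 \<le> e \<Longrightarrow> 0 \<in> coord_ball e"
  by (simp add: coord_ball_def)

lemma ex_coord_ball: "\<exists>D\<ge>1. x \<in> coord_ball D"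
proof -
  have "absv (coord x b) \<le> 1 + (\<Sum>b\<in>B. absv (coord x b))" if "b \<in> B" for b
    using member_le_sum[OF that _ finite_basis, of "\<lambda>b. absv (coord x b)"] by simp
  moreover have "0 \<le> (\<Sum>b\<in>B. absv (coord x b))"
    by (simp add: sum_nonneg)
  ultimately show ?thesis
    by (intro exI[of _ "1 + (\<Sum>b\<in>B. absv (coord x b))"]) (simp add: coord_ball_def)
qed

text \<open>In an ultrametric a closed ball is a neighbourhood of each of its points, with the same
  radius.\<close>

lemma open_absv_ball: "e > 0 \<Longrightarrow> open {z :: 'k. absv (z - c) \<le> e}"
  unfolding open_dist
proof (intro ballI exI conjI allI impI)
  fix z y :: 'k
  assume "0 < e" "z \<in> {z. absv (z - c) \<le> e}" "dist y z < e"
  then show "y \<in> {z. absv (z - c) \<le> e}"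
    using absv_add_le[of "y - z" e "z - c"] by (simp add: dist_absv)
qed

text \<open>Finiteness of \<open>B\<close> lets one radius serve all coordinates, so the pulled-back
  product topology is that of the maximum norm.\<close>

lemma openin_group_topology_iff:
  "openin group_topology U \<longleftrightarrow> (\<forall>x\<in>U. \<exists>e>0. \<forall>y. y - x \<in> coord_ball e \<longrightarrow> y \<in> U)"
proof
  let ?f = "\<lambda>x. \<lambda>b\<in>B. coord x b"
  assume "openin group_topology U"
  then obtain W where W: "openin (product_topology (\<lambda>_. euclidean) B) W" "U = ?f -` W"
    by (auto simp: group_topology_def openin_pullback_topology)
  show "\<forall>x\<in>U. \<exists>e>0. \<forall>y. y - x \<in> coord_ball e \<longrightarrow> y \<in> U"
  proof
    fix x
    assume "x \<in> U"
    then have "?f x \<in> W"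
      using W(2) by blast
    from bspec[OF W(1)[unfolded openin_product_topology_alt] this]
    obtain S where S: "\<And>b. b \<in> B \<Longrightarrow> openin euclidean (S b)" "?f x \<in> Pi\<^sub>E B S" "Pi\<^sub>E B S \<subseteq> W"
      by auto
    have "\<exists>e>0. \<forall>z. dist z (coord x b) < e \<longrightarrow> z \<in> S b" if b: "b \<in> B" for b
    proof -
      have "open (S b)"
        using S(1)[OF b] by simp
      moreover have "coord x b \<in> S b"
        using PiE_mem[OF S(2) b] b by simp
      ultimately show ?thesis
        unfolding open_dist by blast
    qed
    then obtain r where r: "\<And>b. b \<in> B \<Longrightarrow> r b > 0"
      "\<And>b z. b \<in> B \<Longrightarrow> dist z (coord x b) < r b \<Longrightarrow> z \<in> S b"
      by metis
    \<comment> \<open>Halving makes \<open>e\<close> strictly smaller than each \<open>r b\<close>,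
      as \<open>coord_ball\<close> uses \<le> and the neighbourhoods use <. Inserting 1 keeps the
      set nonempty.\<close>
    define e where "e = Min (insert 1 (r ` B)) / 2"
    have e: "e > 0" "\<And>b. b \<in> B \<Longrightarrow> e < r b"
    proof -
      have "Min (insert 1 (r ` B)) > 0"
        using r(1) finite_basis by (subst Min_gr_iff) auto
      then show "e > 0"
        by (simp add: e_def)
      fix b
      assume "b \<in> B"
      then have "Min (insert 1 (r ` B)) \<le> r b"
        using finite_basis by (intro Min_le) auto
      with \<open>e > 0\<close> show "e < r b"
        unfolding e_def by linarith
    qed
    have "y \<in> U" if y: "y - x \<in> coord_ball e" for y
    proof -
      have "coord y b \<in> S b" if b: "b \<in> B" for b
      proof (rule r(2)[OF b])
        have "absv (coord y b - coord x b) \<le> e"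
          using y b by (simp add: coord_ball_def)
        then show "dist (coord y b) (coord x b) < r b"
          using e(2)[OF b] by (simp add: dist_absv)
      qed
      then have "?f y \<in> Pi\<^sub>E B S"
        by auto
      then show ?thesis
        using S(3) W(2) by blast
    qed
    then show "\<exists>e>0. \<forall>y. y - x \<in> coord_ball e \<longrightarrow> y \<in> U"
      using e(1) by blast
  qed
next
  let ?f = "\<lambda>x. \<lambda>b\<in>B. coord x b"
  assume "\<forall>x\<in>U. \<exists>e>0. \<forall>y. y - x \<in> coord_ball e \<longrightarrow> y \<in> U"
  then obtain e where e: "\<And>x. x \<in> U \<Longrightarrow> e x > 0" "\<And>x y. x \<in> U \<Longrightarrow> y - x \<in> coord_ball (e x) \<Longrightarrow> y \<in> U"
    by metis
  define W where "W = (\<Union>x\<in>U. Pi\<^sub>E B (\<lambda>b. {z. absv (z - coord x b) \<le> e x}))"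
  have "openin (product_topology (\<lambda>_. euclidean) B) W"
    unfolding W_def
  proof (intro openin_Union ballI, clarify)
    fix x
    assume "x \<in> U"
    then show "openin (product_topology (\<lambda>_. euclidean) B) (Pi\<^sub>E B (\<lambda>b. {z. absv (z - coord x b) \<le> e x}))"
      using finite_basis e(1) by (subst openin_PiE) (auto intro: open_absv_ball)
  qed
  moreover have "U = ?f -` W"
  proof (intro equalityI subsetI)
    fix x
    assume "x \<in> U"
    moreover have "?f x \<in> Pi\<^sub>E B (\<lambda>b. {z. absv (z - coord x b) \<le> e x})"
      using e(1)[OF \<open>x \<in> U\<close>] by auto
    ultimately show "x \<in> ?f -` W"
      by (auto simp: W_def)
  next
    fix y
    assume "y \<in> ?f -` W"
    then obtain x where x: "x \<in> U" "?f y \<in> Pi\<^sub>E B (\<lambda>b. {z. absv (z - coord x b) \<le> e x})"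
      by (auto simp: W_def)
    have "absv (coord y b - coord x b) \<le> e x" if "b \<in> B" for b
      using PiE_mem[OF x(2) that] that by simp
    then show "y \<in> U"
      using e(2)[OF x(1)] by (simp add: coord_ball_def)
  qed
  ultimately show "openin group_topology U"
    unfolding group_topology_def openin_pullback_topology by blast
qed

lemma topspace_group_topology [simp]: "topspace group_topology = UNIV"
proof -
  have "openin group_topology UNIV"
    unfolding openin_group_topology_iff by (auto intro: exI[of _ 1])
  then show ?thesis
    using openin_subset by blast
qed

text \<open>The type \<open>'g\<close> carries no topological type class, so continuity is phrased
  by radii in coordinates.\<close>

definition coord_continuous :: "('g \<Rightarrow> 'g) \<Rightarrow> bool" where
  "coord_continuous f \<longleftrightarrow> (\<forall>x. \<forall>e>0. \<exists>d>0. \<forall>y. y - x \<in> coord_ball d \<longrightarrow> f y - f x \<in> coord_ball e)"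

lemma coord_continuous_vimage:
  assumes "coord_continuous f" "openin group_topology U"
  shows "openin group_topology (f -` U)"
  unfolding openin_group_topology_iff
proof
  fix x
  assume "x \<in> f -` U"
  then obtain e where e: "e > 0" "\<And>y. y - f x \<in> coord_ball e \<Longrightarrow> y \<in> U"
    using assms(2) unfolding openin_group_topology_iff by fastforce
  obtain d where "d > 0" "\<And>y. y - x \<in> coord_ball d \<Longrightarrow> f y - f x \<in> coord_ball e"
    using assms(1) e(1) unfolding coord_continuous_def by metis
  then show "\<exists>e>0. \<forall>y. y - x \<in> coord_ball e \<longrightarrow> y \<in> f -` U"
    using e(2) by blast
qed

section \<open>Continuity of the bracket and of the group law\<close>

lemma coord_continuous_const: "coord_continuous (\<lambda>_. c)"
proof -
  have "c - c \<in> coord_ball e" if "e > 0" for e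
    using that by (simp add: zero_mem_coord_ball)
  then show ?thesis
    unfolding coord_continuous_def using zero_less_one by blast
qed

lemma coord_continuous_id: "coord_continuous (\<lambda>x. x)"
  unfolding coord_continuous_def by blast

lemma coord_continuousD2:
  assumes "coord_continuous f" "coord_continuous g" "e > 0"
  obtains d where "d > 0" "\<And>y. y - x \<in> coord_ball d \<Longrightarrow> f y - f x \<in> coord_ball e \<and> g y - g x \<in> coord_ball e"
proof -
  obtain d where d: "d > 0" "\<And>y. y - x \<in> coord_ball d \<Longrightarrow> f y - f x \<in> coord_ball e"
    using assms(1,3) unfolding coord_continuous_def by metis
  obtain d' where d': "d' > 0" "\<And>y. y - x \<in> coord_ball d' \<Longrightarrow> g y - g x \<in> coord_ball e"
    using assms(2,3) unfolding coord_continuous_def by metis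
  show ?thesis
    by (rule that[of "min d d'"]) (use d d' coord_ball_mono in \<open>auto simp: min_def split: if_splits\<close>)
qed

lemma coord_continuous_add:
  assumes "coord_continuous f" "coord_continuous g"
  shows "coord_continuous (\<lambda>x. f x + g x)"
  unfolding coord_continuous_def
proof (intro allI impI)
  fix x and e :: real
  assume "e > 0"
  then obtain d where d: "d > 0"
    "\<And>y. y - x \<in> coord_ball d \<Longrightarrow> f y - f x \<in> coord_ball e \<and> g y - g x \<in> coord_ball e"
    using coord_continuousD2[OF assms] by metis
  have "f y + g y - (f x + g x) \<in> coord_ball e" if "y - x \<in> coord_ball d" for y
    using d(2)[OF that] coord_ball_add[of "f y - f x" e "g y - g x"] by (simp add: algebra_simps)
  with d(1) show "\<exists>d>0. \<forall>y. y - x \<in> coord_ball d \<longrightarrow> f y + g y - (f x + g x) \<in> coord_ball e"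
    by blast
qed

lemma coord_continuous_sum:
  "(\<And>i. i \<in> I \<Longrightarrow> coord_continuous (f i)) \<Longrightarrow> coord_continuous (\<lambda>x. \<Sum>i\<in>I. f i x)"
  by (induction I rule: infinite_finite_induct) (simp_all add: coord_continuous_const coord_continuous_add)

lemma coord_continuous_scale:
  assumes "coord_continuous f"
  shows "coord_continuous (\<lambda>x. c *\<^sub>K f x)"
  unfolding coord_continuous_def
proof (intro allI impI)
  fix x and e :: real
  assume e: "e > 0"
  define D where "D = absv c + 1"
  have D: "D > 0" "absv c \<le> D"
    by (auto simp: D_def intro: add_nonneg_pos)
  obtain d where d: "d > 0" "\<And>y. y - x \<in> coord_ball d \<Longrightarrow> f y - f x \<in> coord_ball (e / D)"
    using assms e D(1) unfolding coord_continuous_def by (metis divide_pos_pos)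
  have "c *\<^sub>K f y - c *\<^sub>K f x \<in> coord_ball e" if "y - x \<in> coord_ball d" for y
  proof -
    have "absv (c * (coord (f y) b - coord (f x) b)) \<le> D * (e / D)" if "b \<in> B" for b
      unfolding absv_mult using d(2)[OF \<open>y - x \<in> coord_ball d\<close>] D that
      by (intro mult_mono) (auto simp: coord_ball_def)
    then show ?thesis
      using D by (simp add: coord_ball_def algebra_simps)
  qed
  with d(1) show "\<exists>d>0. \<forall>y. y - x \<in> coord_ball d \<longrightarrow> c *\<^sub>K f y - c *\<^sub>K f x \<in> coord_ball e"
    by blast
qed

lemma bracket_bounded:
  "\<exists>C>0. \<forall>x y d e. 0 \<le> d \<longrightarrow> 0 \<le> e \<longrightarrow> x \<in> coord_ball d \<longrightarrow> y \<in> coord_ball e \<longrightarrow> bracket x y \<in> coord_ball (C * d * e)"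
proof -
  let ?S = "\<lambda>b c. \<Sum>k\<in>B. absv (coord (bracket b c) k)"
  \<comment> \<open>One plus the sum of the absolute values of all structure constants: positive,
    and a bound for each of them.\<close>
  define C where "C = 1 + (\<Sum>b\<in>B. \<Sum>c\<in>B. ?S b c)"
  have C_pos: "C > 0"
    unfolding C_def by (simp add: sum_nonneg add_pos_nonneg)
  have C: "absv (coord (bracket b c) k) \<le> C" if "b \<in> B" "c \<in> B" "k \<in> B" for b c k
  proof -
    have "absv (coord (bracket b c) k) \<le> ?S b c"
      using that finite_basis by (intro member_le_sum[of k B "\<lambda>k. absv (coord (bracket b c) k)"]) auto
    also have "\<dots> \<le> (\<Sum>c\<in>B. ?S b c)"
      using that finite_basis by (intro member_le_sum[of c B "?S b"]) (auto intro!: sum_nonneg)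
    also have "\<dots> \<le> (\<Sum>b\<in>B. \<Sum>c\<in>B. ?S b c)"
      using that finite_basis by (intro member_le_sum[of b B "\<lambda>b. \<Sum>c\<in>B. ?S b c"]) (auto intro!: sum_nonneg)
    finally show ?thesis
      by (simp add: C_def)
  qed
  have "bracket x y \<in> coord_ball (C * d * e)"
    if de: "0 \<le> d" "0 \<le> e" and xy: "x \<in> coord_ball d" "y \<in> coord_ball e" for x y d e
    unfolding coord_ball_def
  proof (intro CollectI ballI)
    fix k
    assume k: "k \<in> B"
    have "coord (bracket x y) k = (\<Sum>b\<in>B. \<Sum>c\<in>B. (coord x b * coord y c) * coord (bracket b c) k)"
      by (subst bracket_expand) simp
    also have "absv \<dots> \<le> C * d * e"
    proof (intro absv_sum_le)
      fix b c
      assume bc: "b \<in> B" "c \<in> B"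
      have "absv (coord x b) * absv (coord y c) * absv (coord (bracket b c) k) \<le> d * e * C"
        using bc k xy de C[OF bc k] by (intro mult_mono) (auto simp: coord_ball_def)
      then show "absv ((coord x b * coord y c) * coord (bracket b c) k) \<le> C * d * e"
        by (simp add: absv_mult mult_ac)
    qed (use C_pos de in auto)
    finally show "absv (coord (bracket x y) k) \<le> C * d * e" .
  qed
  with C_pos show ?thesis
    by blast
qed

lemma coord_continuous_bracket:
  assumes "coord_continuous f" "coord_continuous g"
  shows "coord_continuous (\<lambda>x. bracket (f x) (g x))"
  unfolding coord_continuous_def
proof (intro allI impI)
  fix x and e :: real
  assume e: "e > 0"
  obtain C where C: "C > 0" "\<And>x y d e. 0 \<le> d \<Longrightarrow> 0 \<le> e \<Longrightarrow> x \<in> coord_ball d \<Longrightarrow> y \<in> coord_ball e \<Longrightarrow>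
      bracket x y \<in> coord_ball (C * d * e)"
    using bracket_bounded by metis
  obtain D where D: "D \<ge> 1" "f x \<in> coord_ball D" "g x \<in> coord_ball D"
  proof -
    obtain D1 D2 where "D1 \<ge> 1" "f x \<in> coord_ball D1" "D2 \<ge> 1" "g x \<in> coord_ball D2"
      using ex_coord_ball by metis
    then show ?thesis
      using that[of "max D1 D2"] coord_ball_mono by (meson max.cobounded1 max.cobounded2 order_trans)
  qed
  \<comment> \<open>Since h \<le> 1 \<le> D, this one radius bounds the mixed brackets by C * D * h
    and the quadratic one by C * h * h, all at most e.\<close>
  define h where "h = min 1 (e / (C * D))"
  have h: "h > 0" "h \<le> 1" "C * D * h \<le> e"
  proof -
    show "h > 0"
      using e C D by (simp add: h_def)
    show "h \<le> 1"
      by (simp add: h_def)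
    have "C * D > 0"
      using C D by simp
    moreover have "h \<le> e / (C * D)"
      by (simp add: h_def)
    ultimately show "C * D * h \<le> e"
      by (simp add: field_simps)
  qed
  have "C * h * h \<le> C * D * h"
    using C(1) D(1) h by (intro mult_right_mono mult_left_mono) auto
  note le = order_trans[OF this h(3)] h(3)
  obtain d where d: "d > 0"
    "\<And>y. y - x \<in> coord_ball d \<Longrightarrow> f y - f x \<in> coord_ball h \<and> g y - g x \<in> coord_ball h"
    using coord_continuousD2[OF assms h(1)] by metis
  have "bracket (f y) (g y) - bracket (f x) (g x) \<in> coord_ball e" if y: "y - x \<in> coord_ball d" for y
  proof -
    define u v where "u = f y - f x" and "v = g y - g x"
    have uv: "u \<in> coord_ball h" "v \<in> coord_ball h"
      using d(2)[OF y] by (auto simp: u_def v_def)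
    have "bracket u v \<in> coord_ball e"
      using C(2)[of h h u v] uv h le coord_ball_mono by auto
    moreover have "bracket u (g x) \<in> coord_ball e"
      using C(2)[of h D u "g x"] uv D h le coord_ball_mono by (auto simp: mult_ac)
    moreover have "bracket (f x) v \<in> coord_ball e"
      using C(2)[of D h "f x" v] uv D h le coord_ball_mono by (auto simp: mult_ac)
    moreover have "bracket (f y) (g y) - bracket (f x) (g x) = bracket u v + bracket u (g x) + bracket (f x) v"
    proof -
      have "f y = f x + u" "g y = g x + v"
        by (simp_all add: u_def v_def)
      then show ?thesis
        by (simp only: bracket_add_left bracket_add_right) (simp add: algebra_simps)
    qed
    ultimately show ?thesis
      by (simp add: coord_ball_add)
  qed
  with d(1) show "\<exists>d>0. \<forall>y. y - x \<in> coord_ball d \<longrightarrow>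
      bracket (f y) (g y) - bracket (f x) (g x) \<in> coord_ball e"
    by blast
qed

text \<open>The letters are functions of the point, so that the induction runs over a fixed word
  while the point varies; \<open>map_dynkin_word\<close> links this to Dynkin words.\<close>

lemma coord_continuous_nested_bracket:
  "\<forall>f\<in>set fs. coord_continuous f \<Longrightarrow> coord_continuous (\<lambda>x. nested_bracket (map (\<lambda>f. f x) fs))"
proof (induction fs)
  case (Cons f fs)
  then have IH: "coord_continuous (\<lambda>x. nested_bracket (map (\<lambda>f. f x) fs))" and f: "coord_continuous f"
    by auto
  show ?case
  proof (cases fs)
    case Nil
    with f show ?thesis
      by simp
  next
    case (Cons g gs)
    with coord_continuous_bracket[OF f IH] show ?thesis
      by simp
  qed
qed (simp add: coord_continuous_const)

lemma map_dynkin_word: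
  "map h (concat (map (\<lambda>(r, s). replicate r u @ replicate s v) rs)) =
   concat (map (\<lambda>(r, s). replicate r (h u) @ replicate s (h v)) rs)"
  by (induction rs) auto

lemma coord_continuous_bch:
  assumes "coord_continuous u" "coord_continuous v"
  shows "coord_continuous (\<lambda>x. bch (u x) (v x))"
  unfolding bch_def
proof (intro coord_continuous_sum)
  fix d rs
  define fs where "fs = concat (map (\<lambda>(r, s). replicate r u @ replicate s v) rs)"
  have "set fs \<subseteq> {u, v}"
    unfolding fs_def by (rule set_dynkin_word)
  then have "coord_continuous (\<lambda>x. nested_bracket (map (\<lambda>f. f x) fs))"
    using assms by (intro coord_continuous_nested_bracket) blast
  then show "coord_continuous (\<lambda>x. dynkin_term (u x) (v x) rs)"
    unfolding dynkin_term_def fs_def map_dynkin_word by (rule coord_continuous_scale)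
qed

section \<open>Size of the dilated lattices\<close>

lemma powi_pi_le: "n \<ge> 0 \<Longrightarrow> b \<in> B \<Longrightarrow> absv \<pi> powi (n * int (weight b)) \<le> absv \<pi> powi n"
proof -
  assume n: "n \<ge> 0" and b: "b \<in> B"
  have "nat n \<le> nat n * weight b"
    using weight_pos[OF b] by simp
  then have "absv \<pi> ^ (nat n * weight b) \<le> absv \<pi> ^ nat n"
    using absv_pi_bounds by (intro power_decreasing) (auto intro: less_imp_le)
  then show ?thesis
    using n by (simp add: power_int_def nat_mult_distrib)
qed

lemma ex_G_sub_subset_coord_ball:
  assumes "e > 0"
  shows "\<exists>n. G_sub n \<subseteq> coord_ball e"
proof -
  obtain k where "absv \<pi> ^ k < e"
    using real_arch_pow_inv[OF assms absv_pi_bounds(2)] by blast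
  then have bound: "absv \<pi> powi (int k * int (weight b)) \<le> e" if "b \<in> B" for b
    using powi_pi_le[of "int k" b] that by simp
  have "x \<in> coord_ball e" if x: "x \<in> G_sub (int k)" for x
    unfolding coord_ball_def
  proof (intro CollectI ballI)
    fix b
    assume b: "b \<in> B"
    then have "absv (coord x b) \<le> absv \<pi> powi (int k * int (weight b))"
      using x unfolding G_sub_iff by blast
    also have "\<dots> \<le> e"
      by (rule bound[OF b])
    finally show "absv (coord x b) \<le> e" .
  qed
  then show ?thesis
    by blast
qed

text \<open>Weights are at least 1, so a dilation by \<pi>^(-k) enlarges every coordinate bound at
  least to the inverse of |\<pi>|^k, which exceeds any given size.\<close>

lemma ex_mem_G_sub: "\<exists>n. x \<in> G_sub n"
proof -
  obtain D where D: "D \<ge> 1" "x \<in> coord_ball D"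
    using ex_coord_ball by blast
  obtain k where k: "absv \<pi> ^ k < inverse D"
    using real_arch_pow_inv[of "inverse D" "absv \<pi>"] D by auto
  have "absv (coord x b) \<le> absv \<pi> powi (- int k * int (weight b))" if b: "b \<in> B" for b
  proof -
    have pos: "0 < absv \<pi> powi (int k * int (weight b))"
      by (simp add: zero_less_power_int)
    have "absv \<pi> powi (int k * int (weight b)) \<le> inverse D"
      using powi_pi_le[of "int k" b] b k by simp
    then have "inverse (inverse D) \<le> inverse (absv \<pi> powi (int k * int (weight b)))"
      using pos by (intro le_imp_inverse_le)
    also have "\<dots> = absv \<pi> powi (- int k * int (weight b))"
      by (simp add: power_int_minus)
    finally show ?thesis
      using D b by (force simp: coord_ball_def)
  qed
  then show ?thesis
    unfolding G_sub_iff by blast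
qed

lemma ex_not_mem_G_sub:
  assumes "x \<noteq> 0"
  shows "\<exists>n. x \<notin> G_sub n"
proof -
  obtain b where b: "b \<in> B" "coord x b \<noteq> 0"
    using assms unfolding vec_eq_iff by auto
  then have "absv (coord x b) / 2 > 0"
    by simp
  then obtain n where "G_sub n \<subseteq> coord_ball (absv (coord x b) / 2)"
    using ex_G_sub_subset_coord_ball by blast
  moreover have "x \<notin> coord_ball (absv (coord x b) / 2)"
  proof
    assume "x \<in> coord_ball (absv (coord x b) / 2)"
    then have "absv (coord x b) \<le> absv (coord x b) / 2"
      using b(1) by (simp add: coord_ball_def)
    with \<open>absv (coord x b) / 2 > 0\<close> show False
      by linarith
  qed
  ultimately show ?thesis
    by blast
qed

end

section \<open>The fundamental solution\<close>

context graded_lie_group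
begin

interpretation G: group exp_group
  by (rule group_exp)

lemma openin_left_translation: "openin group_topology U \<Longrightarrow> openin group_topology {y. g \<odot> y \<in> U}"
  using coord_continuous_vimage[OF coord_continuous_bch[OF coord_continuous_const[of g] coord_continuous_id]]
  by (simp add: mult_eq_bch vimage_def)

lemma openin_right_translation: "openin group_topology U \<Longrightarrow> openin group_topology {y. y \<odot> g \<in> U}"
  using coord_continuous_vimage[OF coord_continuous_bch[OF coord_continuous_id coord_continuous_const[of g]]]
  by (simp add: mult_eq_bch vimage_def)

lemma mem_l_coset_iff: "y \<in> x <#\<^bsub>exp_group\<^esub> A \<longleftrightarrow> inv\<^bsub>exp_group\<^esub> x \<odot> y \<in> A"
  by (simp add: G.mem_l_coset_iff_inv)

lemma openin_l_coset: "openin group_topology (x <#\<^bsub>exp_group\<^esub> G_sub n)"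
proof -
  have "x <#\<^bsub>exp_group\<^esub> G_sub n = {y. inv\<^bsub>exp_group\<^esub> x \<odot> y \<in> G_sub n}"
    by (auto simp: mem_l_coset_iff)
  then show ?thesis
    using openin_left_translation[OF openin_G_sub] by simp
qed

lemma openin_r_coset: "openin group_topology (G_sub n #>\<^bsub>exp_group\<^esub> x)"
proof -
  have "G_sub n #>\<^bsub>exp_group\<^esub> x = {y. y \<odot> inv\<^bsub>exp_group\<^esub> x \<in> G_sub n}"
    by (auto simp: G.mem_r_coset_iff_inv)
  then show ?thesis
    using openin_right_translation[OF openin_G_sub] by simp
qed

lemma mem_l_coset_self: "x \<in> x <#\<^bsub>exp_group\<^esub> G_sub n"
  by (simp add: mem_l_coset_iff zero_mem_G_sub)

text \<open>Continuity of left translation moves the question to the identity, where coordinate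
  balls contain some \<open>G_sub n\<close>.\<close>

lemma l_coset_neighbourhood:
  assumes "openin group_topology U" "x \<in> U"
  shows "\<exists>n. x <#\<^bsub>exp_group\<^esub> G_sub n \<subseteq> U"
proof -
  have "x \<odot> 0 = x"
    using G.r_one[of x] by simp
  then have "0 \<in> {y. x \<odot> y \<in> U}"
    using assms(2) by (metis mem_Collect_eq)
  then obtain e where e: "e > 0" "\<And>y. y - 0 \<in> coord_ball e \<Longrightarrow> x \<odot> y \<in> U"
    using openin_left_translation[OF assms(1), of x] unfolding openin_group_topology_iff by blast
  obtain n where "G_sub n \<subseteq> coord_ball e"
    using ex_G_sub_subset_coord_ball[OF e(1)] by blast
  then have "x <#\<^bsub>exp_group\<^esub> G_sub n \<subseteq> U"
    using e(2) by (auto simp: l_coset_def)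
  then show ?thesis ..
qed

lemma space_haar: "space \<mu> = UNIV"
  using sets_eq_imp_space_eq[OF sets_haar] by simp

lemma openin_imp_sets: "openin group_topology U \<Longrightarrow> U \<in> sets \<mu>"
  unfolding sets_haar by simp

lemma translation_measurable: "(\<otimes>\<^bsub>exp_group\<^esub>) g \<in> \<mu> \<rightarrow>\<^sub>M \<mu>"
proof -
  have "(\<otimes>\<^bsub>exp_group\<^esub>) g \<in> \<mu> \<rightarrow>\<^sub>M sigma UNIV {U. openin group_topology U}"
  proof (rule measurable_measure_of)
    fix U
    assume "U \<in> {U. openin group_topology U}"
    then have "openin group_topology ((\<otimes>\<^bsub>exp_group\<^esub>) g -` U)"
      using openin_left_translation[of U g] by (simp add: vimage_def)
    then show "(\<otimes>\<^bsub>exp_group\<^esub>) g -` U \<inter> space \<mu> \<in> sets \<mu>"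
      by (simp add: space_haar openin_imp_sets)
  qed auto
  then show ?thesis
    using measurable_cong_sets[OF refl sets_haar] by blast
qed

text \<open>Invariance is given for images, a push-forward measures preimages; the preimage under
  translation by \<open>g\<close> is the image under translation by its inverse.\<close>

lemma haar_distr_translation: "distr \<mu> \<mu> ((\<otimes>\<^bsub>exp_group\<^esub>) g) = \<mu>"
proof (rule measure_eqI)
  fix A
  assume "A \<in> sets (distr \<mu> \<mu> ((\<otimes>\<^bsub>exp_group\<^esub>) g))"
  then have A: "A \<in> sets \<mu>"
    by simp
  have "(\<otimes>\<^bsub>exp_group\<^esub>) g -` A = (\<lambda>x. inv\<^bsub>exp_group\<^esub> g \<odot> x) ` A"
  proof (intro equalityI subsetI)
    fix x
    assume "x \<in> (\<otimes>\<^bsub>exp_group\<^esub>) g -` A"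
    then have "g \<odot> x \<in> A" "x = inv\<^bsub>exp_group\<^esub> g \<odot> (g \<odot> x)"
      by (simp_all add: inv_mult_cancel)
    then show "x \<in> (\<lambda>x. inv\<^bsub>exp_group\<^esub> g \<odot> x) ` A"
      by blast
  qed (auto simp: inv_mult_cancel)
  then show "emeasure (distr \<mu> \<mu> ((\<otimes>\<^bsub>exp_group\<^esub>) g)) A = emeasure \<mu> A"
    using A haar_left_invariant[OF A, of "inv\<^bsub>exp_group\<^esub> g"]
    by (simp add: emeasure_distr translation_measurable space_haar)
qed simp

lemma homogeneous_dim_pos: "homogeneous_dim > 0"
proof -
  obtain x :: 'g where "x \<noteq> 0"
    using nontrivial by blast
  then obtain b where b: "b \<in> B"
    unfolding vec_eq_iff by blast
  have "0 < weight b"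
    using weight_pos[OF b] .
  also have "\<dots> \<le> homogeneous_dim"
    unfolding homogeneous_dim_eq using finite_basis b by (intro member_le_sum) auto
  finally show ?thesis .
qed

sublocale haar: haar_filtration exp_group G_sub \<mu> "residue_card TYPE('k)" homogeneous_dim
proof unfold_locales
  show "G_sub (n + 1) \<subseteq> G_sub n" for n
    by (rule G_sub_Suc_subset)
  show "\<exists>n. x \<in> G_sub n" for x
    by (rule ex_mem_G_sub)
  show "\<exists>n. x \<notin> G_sub n" if "x \<noteq> \<one>\<^bsub>exp_group\<^esub>" for x
    using that ex_not_mem_G_sub by simp
qed (simp_all add: G_sub_closed zero_mem_G_sub residue_card_gt_1 homogeneous_dim_pos space_haar translation_measurable
    haar_distr_translation openin_imp_sets openin_G_sub openin_r_coset haar_normalised G_sub_transversal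
    del: One_nat_def)

lemma gnorm_eq_hnorm: "gnorm x = haar.hnorm x"
  by (simp add: gnorm_def haar.hnorm_def)

lemma vladimirov_taibleson_eq_vt: "vladimirov_taibleson \<alpha> f x = haar.vt \<alpha> f x"
  by (simp add: vladimirov_taibleson_def haar.vt_def gnorm_eq_hnorm Let_def)

text \<open>Compactness of the support makes local constancy uniform: finitely many cosets of
  constancy cover it, and the largest of their indices serves as \<open>N\<close>. A coset based
  outside the support but meeting it is rebased at a point of the support.\<close>

lemma test_function_locally_constant:
  assumes f: "f \<in> test_functions"
  shows "\<exists>N. \<forall>x. \<forall>y \<in> x <#\<^bsub>exp_group\<^esub> G_sub N. f y = f x"
proof -
  note [simp] = mem_l_coset_iff
  let ?S = "group_topology closure_of {x. f x \<noteq> 0}"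
  have supp: "{x. f x \<noteq> 0} \<subseteq> ?S"
    by (rule closure_of_subset) simp
  have comp: "compactin group_topology ?S"
    using f by (simp add: test_functions_def)
  have "\<exists>n. \<forall>y \<in> x <#\<^bsub>exp_group\<^esub> G_sub n. f y = f x" for x
  proof -
    obtain U where "openin group_topology U" "x \<in> U" "\<forall>y\<in>U. f y = f x"
      using f unfolding test_functions_def by blast
    then show ?thesis
      using l_coset_neighbourhood[of U x] by blast
  qed
  then obtain n where n: "\<And>x y. y \<in> x <#\<^bsub>exp_group\<^esub> G_sub (n x) \<Longrightarrow> f y = f x"
    by metis
  have "\<exists>\<F>. finite \<F> \<and> \<F> \<subseteq> range (\<lambda>x. x <#\<^bsub>exp_group\<^esub> G_sub (n x)) \<and> ?S \<subseteq> \<Union>\<F>"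
    using mem_l_coset_self by (intro compactinD[OF comp]) (auto intro: openin_l_coset simp del: mem_l_coset_iff)
  then obtain \<F> where \<F>: "finite \<F>" "\<F> \<subseteq> range (\<lambda>x. x <#\<^bsub>exp_group\<^esub> G_sub (n x))" "?S \<subseteq> \<Union>\<F>"
    by blast
  obtain X where "finite X" "\<F> = (\<lambda>x. x <#\<^bsub>exp_group\<^esub> G_sub (n x)) ` X"
    using finite_subset_image[OF \<F>(1,2)] by blast
  with \<F>(3) have X: "finite X" "?S \<subseteq> (\<Union>x\<in>X. x <#\<^bsub>exp_group\<^esub> G_sub (n x))"
    by simp_all
  define N where "N = Max (insert 0 (n ` X))"
  have N: "n x \<le> N" if "x \<in> X" for x
    unfolding N_def using that X(1) by (intro Max_ge) auto
  have on_S: "f y = f x" if x: "x \<in> ?S" and y: "y \<in> x <#\<^bsub>exp_group\<^esub> G_sub N" for x y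
  proof -
    obtain z where z: "z \<in> X" "x \<in> z <#\<^bsub>exp_group\<^esub> G_sub (n z)"
      using X(2) x by blast
    have "inv\<^bsub>exp_group\<^esub> x \<odot> y \<in> G_sub (n z)"
      using y haar.H_antimono[OF N[OF z(1)]] by auto
    then have "inv\<^bsub>exp_group\<^esub> z \<odot> x \<odot> (inv\<^bsub>exp_group\<^esub> x \<odot> y) \<in> G_sub (n z)"
      by (rule G_sub_closed(1)[OF z(2)[unfolded mem_l_coset_iff]])
    then have "y \<in> z <#\<^bsub>exp_group\<^esub> G_sub (n z)"
      by (simp add: G.m_assoc inv_mult_cancel)
    then show ?thesis
      using n[of y z] n[OF z(2)] by simp
  qed
  have "f y = f x" if y: "y \<in> x <#\<^bsub>exp_group\<^esub> G_sub N" for x y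
  proof (cases "x \<in> ?S \<or> y \<in> ?S")
    case True
    have "inv\<^bsub>exp_group\<^esub> (inv\<^bsub>exp_group\<^esub> x \<odot> y) \<in> G_sub N"
      by (rule G_sub_closed(2), use y in simp)
    then have "x \<in> y <#\<^bsub>exp_group\<^esub> G_sub N"
      by (simp add: G.inv_mult_group)
    then show ?thesis
      using True on_S[OF _ y] on_S[of y x] by auto
  next
    case False
    then have "f x = 0" "f y = 0"
      using supp by blast+
    then show ?thesis
      by simp
  qed
  then show ?thesis
    by blast
qed

text \<open>The indices are the cosets themselves rather than representatives: distinct indices then
  give disjoint sets, and no value is counted twice.\<close>

lemma test_function_step_function:
  assumes f: "f \<in> test_functions"
  obtains C :: "'g set set" and w g N where "finite C"
    "f = (\<lambda>x. \<Sum>i\<in>C. w i * indicator (g i <#\<^bsub>exp_group\<^esub> G_sub N) x)"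
proof -
  let ?S = "group_topology closure_of {x. f x \<noteq> 0}"
  have supp: "{x. f x \<noteq> 0} \<subseteq> ?S"
    by (rule closure_of_subset) simp
  have comp: "compactin group_topology ?S"
    using f by (simp add: test_functions_def)
  obtain N where N: "\<And>x y. y \<in> x <#\<^bsub>exp_group\<^esub> G_sub N \<Longrightarrow> f y = f x"
    using test_function_locally_constant[OF f] by metis
  have "\<exists>\<F>. finite \<F> \<and> \<F> \<subseteq> range (\<lambda>x. x <#\<^bsub>exp_group\<^esub> G_sub N) \<and> ?S \<subseteq> \<Union>\<F>"
    using mem_l_coset_self by (intro compactinD[OF comp]) (auto intro: openin_l_coset)
  then obtain C where C: "finite C" "C \<subseteq> range (\<lambda>x. x <#\<^bsub>exp_group\<^esub> G_sub N)" "?S \<subseteq> \<Union>C"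
    by blast
  define g where "g c = (SOME x. c = x <#\<^bsub>exp_group\<^esub> G_sub N)" for c
  have g: "g c <#\<^bsub>exp_group\<^esub> G_sub N = c" if "c \<in> C" for c
  proof -
    have "\<exists>x. c = x <#\<^bsub>exp_group\<^esub> G_sub N"
      using C(2) that by blast
    then have "c = g c <#\<^bsub>exp_group\<^esub> G_sub N"
      unfolding g_def by (rule someI_ex)
    then show ?thesis
      by (rule sym)
  qed
  have same: "c = y <#\<^bsub>exp_group\<^esub> G_sub N" if "c \<in> C" "y \<in> c" for c y
  proof -
    have "y \<in> g c <#\<^bsub>exp_group\<^esub> G_sub N"
      using that g by simp
    then have "g c <#\<^bsub>exp_group\<^esub> G_sub N = y <#\<^bsub>exp_group\<^esub> G_sub N"
      by (intro G.l_repr_independence subgroup_G_sub) auto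
    then show ?thesis
      using g that by simp
  qed
  have "f x = (\<Sum>c\<in>C. f (g c) * indicator (g c <#\<^bsub>exp_group\<^esub> G_sub N) x)" for x
  proof (cases "x \<in> \<Union>C")
    case True
    then obtain c where c: "c \<in> C" "x \<in> c"
      by blast
    have "(\<Sum>d\<in>C. f (g d) * indicator (g d <#\<^bsub>exp_group\<^esub> G_sub N) x) =
        (\<Sum>d\<in>C. if d = c then f x else 0)"
    proof (intro sum.cong refl)
      fix d
      assume d: "d \<in> C"
      show "f (g d) * indicator (g d <#\<^bsub>exp_group\<^esub> G_sub N) x = (if d = c then f x else 0)"
      proof (cases "x \<in> d")
        case True
        then have "d = c"
          using same c d by metis
        moreover have "f x = f (g d)"
          using N[of x "g d"] g[OF d] True by simp
        ultimately show ?thesis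
          using True g[OF d] by simp
      next
        case False
        then show ?thesis
          using g[OF d] c(2) by auto
      qed
    qed
    then show ?thesis
      using C(1) c(1) by simp
  next
    case False
    then have "f x = 0"
      using supp C(3) by blast
    moreover have "indicator (g c <#\<^bsub>exp_group\<^esub> G_sub N) x = (0::complex)" if "c \<in> C" for c
      using False g that by auto
    ultimately show ?thesis
      by simp
  qed
  then show ?thesis
    using that[OF C(1), of "\<lambda>c. f (g c)" g N] by blast
qed

lemma fundamental_solution_gnorm_powr:
  fixes \<alpha> :: complex
  defines "q \<equiv> complex_of_nat (residue_card TYPE('k))" and "Q \<equiv> complex_of_nat homogeneous_dim"
  assumes \<alpha>: "Re \<alpha> > 0" "Re \<alpha> \<noteq> real homogeneous_dim"
  shows "fundamental_solution \<alpha> (\<lambda>x. (1 - q powr (- \<alpha>)) / (1 - q powr (\<alpha> - Q)) *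
    complex_of_real (gnorm x) powr (\<alpha> - Q))"
proof -
  define d where "d = (1 - q powr (- \<alpha>)) / (1 - q powr (\<alpha> - Q))"
  define E where "E x = d * haar.kern (\<alpha> - Q) x" for x
  \<comment> \<open>For the exponent \<alpha> - Q the ratio parameter is q^\<alpha>, so Re \<alpha>
    > 0 is what makes the kernel locally integrable.\<close>
  have b: "norm (q powr (\<alpha> - Q) * complex_of_real haar.r) > 1"
    unfolding q_def Q_def haar.q_powr_diff_Q using haar.norm_q_powr_gt_1[OF \<alpha>(1)] haar.r_gt_1
      haar.q_gt_1
    by (simp del: of_real_power)
  have integrable: "integrable \<mu> (\<lambda>x. E x * f x)" if f: "f \<in> test_functions" for f
  proof -
    obtain C :: "'g set set" and w g N where C: "finite C"
      "f = (\<lambda>x. \<Sum>i\<in>C. w i * indicator (g i <#\<^bsub>exp_group\<^esub> G_sub N) x)"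
      using test_function_step_function[OF f] .
    have "integrable \<mu> (\<lambda>x. \<Sum>i\<in>C. d * w i * (haar.kern (\<alpha> - Q) x * indicator (g i <#\<^bsub>exp_group\<^esub> G_sub N) x))"
      by (intro Bochner_Integration.integrable_sum integrable_mult_right haar.integrable_kern_indicator)
        (rule b[unfolded q_def])
    also have "(\<lambda>x. \<Sum>i\<in>C. d * w i * (haar.kern (\<alpha> - Q) x * indicator (g i <#\<^bsub>exp_group\<^esub> G_sub N) x)) =
        (\<lambda>x. E x * f x)"
      by (simp add: C(2) E_def sum_distrib_left mult_ac)
    finally show ?thesis .
  qed
  have conv: "has_bochner_integral \<mu>
      (\<lambda>y. vladimirov_taibleson \<alpha> f y * E (inv\<^bsub>exp_group\<^esub> y \<odot> x)) (f x)"
    if f: "f \<in> test_functions" for f x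
  proof -
    obtain C :: "'g set set" and w g N where C: "finite C"
      "f = (\<lambda>x. \<Sum>i\<in>C. w i * indicator (g i <#\<^bsub>exp_group\<^esub> G_sub N) x)"
      using test_function_step_function[OF f] .
    show ?thesis
      using haar.has_bochner_integral_convolution_step_function[OF \<alpha>, where I = C and w = w and g = g and N = N]
      unfolding vladimirov_taibleson_eq_vt C(2) E_def d_def q_def Q_def by simp
  qed
  have "distribution (\<lambda>\<phi>. LINT x|\<mu>. E x * \<phi> x)"
    unfolding distribution_def
  proof (intro conjI ballI allI)
    fix \<phi> \<psi>
    assume "\<phi> \<in> test_functions" "\<psi> \<in> test_functions"
    then show "(LINT x|\<mu>. E x * (\<phi> x + \<psi> x)) = (LINT x|\<mu>. E x * \<phi> x) + (LINT x|\<mu>. E x * \<psi> x)"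
      using integrable by (simp add: distrib_left)
  next
    fix c \<phi>
    assume "\<phi> \<in> test_functions"
    show "(LINT x|\<mu>. E x * (c * \<phi> x)) = c * (LINT x|\<mu>. E x * \<phi> x)"
      by (simp add: mult.left_commute flip: integral_mult_right_zero)
  qed
  moreover have "convolution (vladimirov_taibleson \<alpha> f) E = f" if "f \<in> test_functions" for f
    unfolding convolution_def using conv[OF that] by (auto intro: has_bochner_integral_integral_eq)
  ultimately have "fundamental_solution \<alpha> E"
    unfolding fundamental_solution_def using integrable conv by (auto simp: has_bochner_integral_iff)
  then show ?thesis
    unfolding E_def d_def haar.kern_def gnorm_eq_hnorm by simp
qed

end

theorem theorem1p13:
  fixes scale :: "'k::nonarch_local_field \<Rightarrow> 'g::ab_group_add \<Rightarrow> 'g"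
    and bracket :: "'g \<Rightarrow> 'g \<Rightarrow> 'g"
    and V :: "nat \<Rightarrow> 'g set"
    and B :: "'g set"
    and \<pi> :: 'k
    and \<mu> :: "'g measure"
    and p :: nat
    and q Q :: nat
    and \<alpha> :: complex
  assumes "prime p" and "p \<noteq> 2" and "absv (of_nat p :: 'k) < 1"
    and "graded_lie_group scale bracket V B \<pi> \<mu>"
    and "q = residue_card TYPE('k)"
    and "Q = graded_lie_algebra.homogeneous_dim scale V"
    and "Re \<alpha> > 0"
    and "\<alpha> \<notin> {2 * complex_of_real pi * \<i> / complex_of_real (ln (real q)) * of_int k | k :: int. True}"
    and "Re \<alpha> \<noteq> real Q"
  shows "graded_lie_group.fundamental_solution scale bracket V B \<pi> \<mu> \<alpha>
    (\<lambda>x. (1 - of_nat q powr (- \<alpha>)) / (1 - of_nat q powr (\<alpha> - of_nat Q)) *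
          complex_of_real (graded_lie_group_basis.gnorm scale bracket V B \<pi> x) powr (\<alpha> - of_nat Q))"
  using graded_lie_group.fundamental_solution_gnorm_powr[OF assms(4,7)] assms(5,6,9) by simp

end
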